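(* Let $(X,\mu)$ and $(Y,\nu)$ be finite measure spaces, $f\in L^1(X,\mathbb{R})$, $g\in L^1(Y,\mathbb{R})$, $h\in L^1(X,(0,\infty))$, $k\in L^1(Y,(0,\infty))$, with $\int_X h\,d\mu=\int_Y k\,d\nu$. The following are equivalent: (1) There exists a stochastic operator $S:L^1(Y,\nu)\to L^1(X,\mu)$ such that $Sg=f$ and $Sk=h$. (2) For all real-valued convex functions $\phi$ on $\mathbb{R}$, $$\int_X \phi\left(\frac{f}{h}\right)h\,d\mu\le\int_Y\phi\left(\frac{g}{k}\right)k\,d\nu.$$ (3) There exists a doubly stochastic operator $D:L^1(Y,\beta)\to L^1(X,\alpha)$ such that $D\left(\frac{g}{k}\right)=\frac{f}{h}$, where the measures $\alpha$ and $\beta$ are defined by $\alpha=h\,d\mu$ and $\beta=k\,d\nu$.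
   Context: $L^1(X,(0,\infty))$ denotes the $\mu$-integrable functions on $X$ with values in $(0,\infty)$, and similarly for $Y$ with $\nu$. The integrals in (2) are understood as elements of $(-\infty,+\infty]$ (the negative parts of the integrands are integrable). For $\sigma$-finite measure spaces, a linear operator $S:L^1(Y,\nu)\to L^1(X,\mu)$ is a stochastic operator if it is positive (it maps nonnegative functions to nonnegative functions) and $\int_X Su\,d\mu=\int_Y u\,d\nu$ for all $u\in L^1(Y,\nu)$. It is a doubly stochastic operator if, in addition, $\mu(X)=\nu(Y)<\infty$ and $S1=1$. In (3) this definition is applied with the measures $\alpha$ on $X$ and $\beta$ on $Y$. *)

theory Defs
  imports "HOL-Analysis.Analysis"
begin

text \<open>
  Elements of $L^1$ are represented by integrable functions, equality in $L^1$ being equality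
  almost everywhere.  An operator between $L^1$ spaces is a map on representatives that respects
  this equality; its values outside the integrable functions are irrelevant.
  The domain of the operator comes first: \<open>L1_linear N M S\<close> says that \<open>S\<close> induces
  a linear operator from $L^1(N)$ to $L^1(M)$.
\<close>

definition L1_linear ::
  "'b measure \<Rightarrow> 'a measure \<Rightarrow> (('b \<Rightarrow> real) \<Rightarrow> ('a \<Rightarrow> real)) \<Rightarrow> bool" where
  "L1_linear N M S \<longleftrightarrow>
     (\<forall>u. integrable N u \<longrightarrow> integrable M (S u)) \<and>
     (\<forall>u v. integrable N u \<longrightarrow> integrable N v \<longrightarrow> (AE y in N. u y = v y) \<longrightarrow>
        (AE x in M. S u x = S v x)) \<and>
     (\<forall>u v. integrable N u \<longrightarrow> integrable N v \<longrightarrow>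
        (AE x in M. S (\<lambda>y. u y + v y) x = S u x + S v x)) \<and>
     (\<forall>c u. integrable N u \<longrightarrow> (AE x in M. S (\<lambda>y. c * u y) x = c * S u x))"

definition stochastic_operator ::
  "'b measure \<Rightarrow> 'a measure \<Rightarrow> (('b \<Rightarrow> real) \<Rightarrow> ('a \<Rightarrow> real)) \<Rightarrow> bool" where
  "stochastic_operator N M S \<longleftrightarrow>
     sigma_finite_measure N \<and> sigma_finite_measure M \<and>
     L1_linear N M S \<and>
     (\<forall>u. integrable N u \<longrightarrow> (AE y in N. 0 \<le> u y) \<longrightarrow> (AE x in M. 0 \<le> S u x)) \<and>
     (\<forall>u. integrable N u \<longrightarrow> (\<integral>x. S u x \<partial>M) = (\<integral>y. u y \<partial>N))"

definition doubly_stochastic_operator ::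
  "'b measure \<Rightarrow> 'a measure \<Rightarrow> (('b \<Rightarrow> real) \<Rightarrow> ('a \<Rightarrow> real)) \<Rightarrow> bool" where
  "doubly_stochastic_operator N M S \<longleftrightarrow>
     stochastic_operator N M S \<and>
     emeasure M (space M) = emeasure N (space N) \<and> emeasure N (space N) < \<infinity> \<and>
     (AE x in M. S (\<lambda>y. 1) x = 1)"

text \<open>
  The integral with values in $(-\infty,+\infty]$ of a measurable function whose negative part is
  integrable.  (The Bochner integral would be \<open>0\<close> when the positive part is not integrable.)
\<close>

definition extended_integral :: "'a measure \<Rightarrow> ('a \<Rightarrow> real) \<Rightarrow> ereal" where
  "extended_integral M F =
     enn2ereal (\<integral>\<^sup>+x. ennreal (F x) \<partial>M) - enn2ereal (\<integral>\<^sup>+x. ennreal (- F x) \<partial>M)"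

lemma extended_integral_eq_integral:
  assumes "integrable M F"
  shows "extended_integral M F = ereal (\<integral>x. F x \<partial>M)"
proof -
  have "(\<integral>\<^sup>+x. ennreal (F x) \<partial>M) < \<infinity>" "(\<integral>\<^sup>+x. ennreal (- F x) \<partial>M) < \<infinity>"
    using assms by (auto simp: real_integrable_def less_top)
  then obtain a b where "(\<integral>\<^sup>+x. ennreal (F x) \<partial>M) = ennreal a" "0 \<le> a"
      "(\<integral>\<^sup>+x. ennreal (- F x) \<partial>M) = ennreal b" "0 \<le> b"
    by (auto simp: less_top_ennreal)
  then show ?thesis
    unfolding extended_integral_def using real_lebesgue_integral_def[OF assms]
    by (simp add: enn2ereal_ennreal)
qed

text \<open>The integrands in the convex order condition have integrable negative part.\<close>

lemma convex_perspective_negative_part: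
  fixes \<phi> :: "real \<Rightarrow> real"
  assumes \<phi>: "convex_on UNIV \<phi>" and f: "integrable M f" and h: "integrable M h"
    and pos: "AE x in M. 0 < h x"
  shows "(\<integral>\<^sup>+x. ennreal (- (\<phi> (f x / h x) * h x)) \<partial>M) < \<infinity>"
proof -
  define a b where "a = \<phi> 0" and "b = Inf ((\<lambda>t. (\<phi> 0 - \<phi> t) / (0 - t)) ` ({0<..} \<inter> UNIV))"
  have ab: "a + b * t \<le> \<phi> t" for t
    using convex_le_Inf_differential[OF \<phi>, of 0 t] by (simp add: a_def b_def)
  have "AE x in M. - (\<phi> (f x / h x) * h x) \<le> - (a * h x + b * f x)"
    using pos
  proof eventually_elim
    case (elim x)
    have "(a + b * (f x / h x)) * h x \<le> \<phi> (f x / h x) * h x"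
      using elim by (intro mult_right_mono ab) auto
    moreover have "(a + b * (f x / h x)) * h x = a * h x + b * f x"
      using elim by (simp add: distrib_right)
    ultimately show ?case by simp
  qed
  then have "(\<integral>\<^sup>+x. ennreal (- (\<phi> (f x / h x) * h x)) \<partial>M)
      \<le> (\<integral>\<^sup>+x. ennreal (- (a * h x + b * f x)) \<partial>M)"
    by (intro nn_integral_mono_AE) (auto intro: ennreal_leI)
  also have "\<dots> < \<infinity>"
  proof -
    have "integrable M (\<lambda>x. a * h x + b * f x)" using f h by auto
    then show ?thesis by (auto simp: real_integrable_def less_top)
  qed
  finally show ?thesis .
qed

end

theory Submission
  imports Defs
begin

text \<open>
  The three conditions are proved in a cycle.

  From an operator \<open>S\<close> to the integral inequalities: a convex \<open>\<phi>\<close> is the supremum of countably many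
  affine functions, and a positive linear operator preserves inequalities between linear
  combinations of \<open>g\<close> and \<open>k\<close>.  This yields the Jensen inequality \<open>\<phi> (f / h) h \<le> S (\<phi> (g / k) k)\<close>
  (lemma \<open>stochastic_operator_jensen\<close>), which is integrated.

  From a doubly stochastic \<open>D\<close> to \<open>S\<close>: put \<open>S u = h D (u / k)\<close>
  (theorem \<open>stochastic_operator_of_doubly_stochastic\<close>).

  From the inequalities to \<open>D\<close>: write \<open>F = f / h\<close>, \<open>G = g / k\<close>.  The operator should be
  \<open>u \<mapsto> E(u(y) | x)\<close> for a coupling of \<open>\<alpha>\<close> and \<open>\<beta>\<close> with \<open>E(G(y) | x) = F(x)\<close>.  Such a coupling is
  sought as a linear functional \<open>\<Lambda>\<close> on functions of \<open>(x, y)\<close>, dominated by the sublinear functional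
  \<open>price w = inf {\<integral>a d\<alpha> + \<integral>b d\<beta>}\<close>, the infimum being over \<open>w \<le> a(x) + b(y) + c(x) (G y - F x)\<close> with \<open>c\<close>
  bounded.  By the Hahn--Banach theorem (\<open>linear_functional_below_sublinear\<close>) a linear functional below
  \<open>price\<close> exists as soon as \<open>price\<close> is finite, which amounts to \<open>0 \<le> price 0\<close>.  The latter is the heart
  of the matter (lemma \<open>no_arbitrage\<close>): a superhedge of zero produces a convex function lying above
  \<open>- a\<close> along \<open>F\<close> and below \<open>b\<close> along \<open>G\<close>, and the assumed inequality for this one function gives \<open>0 \<le> \<integral>a + \<integral>b\<close>.

  The functional \<open>\<Lambda>\<close> is only finitely additive on the product.  Nevertheless, for fixed integrable
  \<open>u\<close> the set function \<open>S \<mapsto> \<Lambda> (1\<^sub>S(x) u(y))\<close> is countably additive and absolutely continuous,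
  because the marginals of \<open>\<Lambda>\<close> are measures (lemma \<open>localized_truncation\<close>).  Its Radon--Nikodym
  derivative is \<open>D u\<close> (theorem \<open>doubly_stochastic_operator_of_functional\<close>).
\<close>

section \<open>A dominated extension principle\<close>

text \<open>
  The vector spaces of functions that occur here have a domain depending on two measures, so they
  are sets of functions rather than types.
\<close>

definition function_subspace :: "('c \<Rightarrow> real) set \<Rightarrow> bool" where
  "function_subspace W \<longleftrightarrow> (\<lambda>_. 0) \<in> W \<and>
     (\<forall>u\<in>W. \<forall>v\<in>W. (\<lambda>z. u z + v z) \<in> W) \<and> (\<forall>c. \<forall>u\<in>W. (\<lambda>z. c * u z) \<in> W)"

definition sublinear_on :: "('c \<Rightarrow> real) set \<Rightarrow> (('c \<Rightarrow> real) \<Rightarrow> real) \<Rightarrow> bool" where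
  "sublinear_on W q \<longleftrightarrow>
     (\<forall>u\<in>W. \<forall>v\<in>W. q (\<lambda>z. u z + v z) \<le> q u + q v) \<and>
     (\<forall>c\<ge>0. \<forall>u\<in>W. q (\<lambda>z. c * u z) \<le> c * q u)"

definition linear_functional_on :: "('c \<Rightarrow> real) set \<Rightarrow> (('c \<Rightarrow> real) \<Rightarrow> real) \<Rightarrow> bool" where
  "linear_functional_on W L \<longleftrightarrow>
     (\<forall>u\<in>W. \<forall>v\<in>W. L (\<lambda>z. u z + v z) = L u + L v) \<and>
     (\<forall>c. \<forall>u\<in>W. L (\<lambda>z. c * u z) = c * L u)"

lemma sublinear_onD:
  assumes "sublinear_on W q"
  shows "u \<in> W \<Longrightarrow> v \<in> W \<Longrightarrow> q (\<lambda>z. u z + v z) \<le> q u + q v"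
    and "0 \<le> c \<Longrightarrow> u \<in> W \<Longrightarrow> q (\<lambda>z. c * u z) \<le> c * q u"
  using assms by (auto simp: sublinear_on_def)

lemma function_subspaceD:
  assumes "function_subspace W"
  shows "(\<lambda>_. 0) \<in> W"
    and "u \<in> W \<Longrightarrow> v \<in> W \<Longrightarrow> (\<lambda>z. u z + v z) \<in> W"
    and "u \<in> W \<Longrightarrow> (\<lambda>z. c * u z) \<in> W"
  using assms by (auto simp: function_subspace_def)

lemma sublinear_on_zero:
  assumes W: "function_subspace W" and q: "sublinear_on W q"
  shows "q (\<lambda>_. 0) = 0"
  using sublinear_onD(2)[OF q, of 0 "\<lambda>_. 0"] sublinear_onD(1)[OF q, of "\<lambda>_. 0" "\<lambda>_. 0"]
    function_subspaceD(1)[OF W] by simp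

lemma sublinear_on_scale:
  assumes W: "function_subspace W" and q: "sublinear_on W q" and u: "u \<in> W" and c: "0 \<le> c"
  shows "q (\<lambda>z. c * u z) = c * q u"
proof (cases "c = 0")
  case True
  then show ?thesis using sublinear_on_zero[OF W q] by simp
next
  case False
  with c have c: "c > 0" by simp
  have "q (\<lambda>z. (1 / c) * (c * u z)) \<le> (1 / c) * q (\<lambda>z. c * u z)"
    using sublinear_onD(2)[OF q, of "1 / c" "\<lambda>z. c * u z"] function_subspaceD(3)[OF W u] c by simp
  moreover have "(\<lambda>z. (1 / c) * (c * u z)) = u" using c by simp
  ultimately have "c * q u \<le> q (\<lambda>z. c * u z)" using c by (simp add: field_simps)
  then show ?thesis using sublinear_onD(2)[OF q _ u, of c] c by simp
qed

lemma sublinear_on_neg: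
  assumes W: "function_subspace W" and q: "sublinear_on W q" and u: "u \<in> W"
  shows "- q (\<lambda>z. - 1 * u z) \<le> q u"
  using sublinear_onD(1)[OF q u function_subspaceD(3)[OF W u, of "- 1"]] sublinear_on_zero[OF W q]
  by simp

text \<open>
  The functional \<open>r\<close> asks how cheaply \<open>w\<close> can be bought if any nonnegative multiple of \<open>v\<close> may be
  bought along with it and refunded at the rate \<open>q v\<close>.  Taking \<open>t = 0\<close> shows \<open>r \<le> q\<close>; the infimum is
  finite because \<open>t * q v = q (t v) \<le> q (w + t v) + q (- w)\<close>.
\<close>

lemma sublinear_on_shear:
  assumes W: "function_subspace W" and q: "sublinear_on W q" and v: "v \<in> W"
  defines "r \<equiv> \<lambda>w. if w \<in> W then (INF t\<in>{0..}. q (\<lambda>z. w z + t * v z) - t * q v) else 0"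
  shows "sublinear_on W r"
    and "\<And>w t. w \<in> W \<Longrightarrow> 0 \<le> t \<Longrightarrow> r w \<le> q (\<lambda>z. w z + t * v z) - t * q v"
proof -
  note W_closed = function_subspaceD[OF W]
  have bdd: "bdd_below ((\<lambda>t. q (\<lambda>z. w z + t * v z) - t * q v) ` {0..})" if w: "w \<in> W" for w
  proof (rule bdd_belowI2)
    fix t :: real assume t: "t \<in> {0..}"
    have "q (\<lambda>z. (w z + t * v z) + - 1 * w z) \<le> q (\<lambda>z. w z + t * v z) + q (\<lambda>z. - 1 * w z)"
      using w v by (intro sublinear_onD(1)[OF q] W_closed)
    moreover have "q (\<lambda>z. (w z + t * v z) + - 1 * w z) = t * q v"
      using sublinear_on_scale[OF W q v, of t] t by simp
    ultimately show "- q (\<lambda>z. - 1 * w z) \<le> q (\<lambda>z. w z + t * v z) - t * q v" by simp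
  qed
  show le: "r w \<le> q (\<lambda>z. w z + t * v z) - t * q v" if "w \<in> W" "0 \<le> t" for w t
    using that cINF_lower[OF bdd[OF that(1)], of t] by (simp add: r_def)
  have ge: "m \<le> r w"
    if "w \<in> W" "\<And>t. 0 \<le> t \<Longrightarrow> m \<le> q (\<lambda>z. w z + t * v z) - t * q v" for m w
    using that by (auto simp: r_def intro!: cINF_greatest)
  show "sublinear_on W r"
    unfolding sublinear_on_def
  proof (intro conjI ballI allI impI)
    fix u w assume uw: "u \<in> W" "w \<in> W"
    have *: "r (\<lambda>z. u z + w z) \<le> (q (\<lambda>z. u z + s * v z) - s * q v) + (q (\<lambda>z. w z + t * v z) - t * q v)"
      if st: "0 \<le> s" "0 \<le> t" for s t
    proof -
      have "r (\<lambda>z. u z + w z) \<le> q (\<lambda>z. (u z + w z) + (s + t) * v z) - (s + t) * q v"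
        using uw st by (intro le W_closed) auto
      also have "(\<lambda>z. (u z + w z) + (s + t) * v z) = (\<lambda>z. (u z + s * v z) + (w z + t * v z))"
        by (auto simp: algebra_simps)
      also have "q \<dots> \<le> q (\<lambda>z. u z + s * v z) + q (\<lambda>z. w z + t * v z)"
        using uw v by (intro sublinear_onD(1)[OF q] W_closed)
      finally show ?thesis by (simp add: algebra_simps)
    qed
    have "r (\<lambda>z. u z + w z) - (q (\<lambda>z. w z + t * v z) - t * q v) \<le> r u" if "0 \<le> t" for t
      using *[OF _ that] by (intro ge uw) (simp add: algebra_simps)
    then have "r (\<lambda>z. u z + w z) - r u \<le> r w"
      by (intro ge uw) (simp add: algebra_simps)
    then show "r (\<lambda>z. u z + w z) \<le> r u + r w" by simp
  next
    fix c :: real and u assume c: "0 \<le> c" and u: "u \<in> W"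
    show "r (\<lambda>z. c * u z) \<le> c * r u"
    proof (cases "c = 0")
      case True
      have "r (\<lambda>_. 0) \<le> q (\<lambda>z. 0 + 0 * v z) - 0 * q v"
        by (intro le W_closed) auto
      then show ?thesis using True sublinear_on_zero[OF W q] by simp
    next
      case False
      with c have c: "c > 0" by simp
      have "r (\<lambda>z. c * u z) / c \<le> r u"
      proof (rule ge[OF u])
        fix t :: real assume t: "0 \<le> t"
        have "r (\<lambda>z. c * u z) \<le> q (\<lambda>z. c * u z + (c * t) * v z) - (c * t) * q v"
          using u c t by (intro le W_closed) auto
        also have "(\<lambda>z. c * u z + (c * t) * v z) = (\<lambda>z. c * (u z + t * v z))"
          by (auto simp: algebra_simps)
        also have "q \<dots> \<le> c * q (\<lambda>z. u z + t * v z)"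
          using u v c by (intro sublinear_onD(2)[OF q] W_closed) auto
        finally show "r (\<lambda>z. c * u z) / c \<le> q (\<lambda>z. u z + t * v z) - t * q v"
          using c by (simp add: field_simps)
      qed
      then show ?thesis using c by (simp add: field_simps)
    qed
  qed
qed

text \<open>
  A minimal \<open>q\<close> coincides with each of its shears, and the shear along \<open>v\<close> with \<open>t = 1\<close> then says
  \<open>q u \<le> q (u + v) - q v\<close>, which is the missing half of additivity.  Functionals are normalised to
  vanish outside \<open>W\<close>, so that being minimal pointwise is a statement about their values on \<open>W\<close> alone.
\<close>

lemma minimal_sublinear_is_linear:
  assumes W: "function_subspace W" and q: "sublinear_on W q" and q0: "\<And>w. w \<notin> W \<Longrightarrow> q w = 0"
    and minimal: "\<And>r. sublinear_on W r \<Longrightarrow> (\<And>w. w \<notin> W \<Longrightarrow> r w = 0) \<Longrightarrow> (\<And>w. r w \<le> q w) \<Longrightarrow> r = q"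
  shows "linear_functional_on W q"
proof -
  note W_closed = function_subspaceD[OF W]
  have add: "q (\<lambda>z. u z + v z) = q u + q v" if u: "u \<in> W" and v: "v \<in> W" for u v
  proof -
    define r where
      "r = (\<lambda>w. if w \<in> W then (INF t\<in>{0..}. q (\<lambda>z. w z + t * v z) - t * q v) else 0)"
    have shear: "r w \<le> q (\<lambda>z. w z + t * v z) - t * q v" if "w \<in> W" "0 \<le> t" for w t
      using sublinear_on_shear(2)[OF W q v that] that by (simp add: r_def)
    have "r = q"
    proof (rule minimal[OF sublinear_on_shear(1)[OF W q v, folded r_def]])
      show "r w \<le> q w" for w
      proof (cases "w \<in> W")
        case True
        then show ?thesis using shear[of w 0] by simp
      qed (simp add: q0 r_def)
    qed (simp add: r_def)
    with shear[OF u, of 1] have "q u \<le> q (\<lambda>z. u z + v z) - q v" by simp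
    moreover have "q (\<lambda>z. u z + v z) \<le> q u + q v" by (rule sublinear_onD(1)[OF q u v])
    ultimately show ?thesis by simp
  qed
  have scale: "q (\<lambda>z. c * u z) = c * q u" if u: "u \<in> W" for c u
  proof (cases "0 \<le> c")
    case True
    then show ?thesis by (rule sublinear_on_scale[OF W q u])
  next
    case False
    then have "q (\<lambda>z. (- c) * u z) = (- c) * q u" by (intro sublinear_on_scale[OF W q u]) simp
    moreover have "q (\<lambda>z. c * u z + (- c) * u z) = q (\<lambda>z. c * u z) + q (\<lambda>z. (- c) * u z)"
      using u by (intro add W_closed)
    ultimately show ?thesis using sublinear_on_zero[OF W q] by simp
  qed
  show ?thesis using add scale by (simp add: linear_functional_on_def)
qed

text \<open>
  Lower bounds of chains, for Zorn's lemma.  The infimum is finite since every \<open>q \<le> p\<close> satisfies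
  \<open>- p (- w) \<le> - q (- w) \<le> q w\<close>; it is subadditive because two members of a chain can be replaced by
  the smaller one.
\<close>

lemma sublinear_on_INF_chain:
  assumes W: "function_subspace W" and C: "C \<noteq> {}" "\<And>q. q \<in> C \<Longrightarrow> sublinear_on W q"
    and below: "\<And>q w. q \<in> C \<Longrightarrow> w \<in> W \<Longrightarrow> q w \<le> p w"
    and chain: "\<And>q r. q \<in> C \<Longrightarrow> r \<in> C \<Longrightarrow> (\<forall>w. q w \<le> r w) \<or> (\<forall>w. r w \<le> q w)"
  defines "m \<equiv> \<lambda>w. if w \<in> W then (INF q\<in>C. q w) else 0"
  shows "sublinear_on W m" and "\<And>q w. q \<in> C \<Longrightarrow> w \<in> W \<Longrightarrow> m w \<le> q w"
proof -
  note W_closed = function_subspaceD[OF W]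
  have bdd: "bdd_below ((\<lambda>q. q w) ` C)" if w: "w \<in> W" for w
  proof (rule bdd_belowI2)
    fix q assume q: "q \<in> C"
    show "- p (\<lambda>z. - 1 * w z) \<le> q w"
      using sublinear_on_neg[OF W C(2)[OF q] w] below[OF q W_closed(3)[OF w, of "- 1"]] by simp
  qed
  show le: "m w \<le> q w" if "q \<in> C" "w \<in> W" for q w
    using cINF_lower[OF bdd[OF that(2)] that(1)] that by (simp add: m_def)
  have ge: "s \<le> m w" if "w \<in> W" "\<And>q. q \<in> C \<Longrightarrow> s \<le> q w" for s w
    using that C(1) by (auto simp: m_def intro!: cINF_greatest)
  show "sublinear_on W m"
    unfolding sublinear_on_def
  proof (intro conjI ballI allI impI)
    fix u v assume uv: "u \<in> W" "v \<in> W"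
    have *: "m (\<lambda>z. u z + v z) \<le> q u + r v" if qr: "q \<in> C" "r \<in> C" for q r
    proof -
      obtain s where s: "s \<in> C" "s u \<le> q u" "s v \<le> r v"
        using chain[OF qr] qr by (metis order_refl)
      have "m (\<lambda>z. u z + v z) \<le> s (\<lambda>z. u z + v z)" using uv s by (intro le W_closed)
      also have "\<dots> \<le> s u + s v" by (rule sublinear_onD(1)[OF C(2)[OF s(1)] uv])
      finally show ?thesis using s by simp
    qed
    have "m (\<lambda>z. u z + v z) - r v \<le> m u" if "r \<in> C" for r
      using *[OF _ that] by (intro ge uv) (simp add: algebra_simps)
    then have "m (\<lambda>z. u z + v z) - m u \<le> m v"
      by (intro ge uv) (simp add: algebra_simps)
    then show "m (\<lambda>z. u z + v z) \<le> m u + m v" by simp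
  next
    fix c :: real and u assume c: "0 \<le> c" and u: "u \<in> W"
    have *: "m (\<lambda>z. c * u z) \<le> c * q u" if "q \<in> C" for q
      using le[OF that W_closed(3)[OF u, of c]] sublinear_onD(2)[OF C(2)[OF that] c u] by simp
    show "m (\<lambda>z. c * u z) \<le> c * m u"
    proof (cases "c = 0")
      case True
      then show ?thesis using * C(1) by auto
    next
      case False
      with c have c: "c > 0" by simp
      have "m (\<lambda>z. c * u z) / c \<le> m u"
        using * c by (intro ge u) (simp add: field_simps)
      then show ?thesis using c by (simp add: field_simps)
    qed
  qed
qed

text \<open>
  The Hahn--Banach theorem for extension from the zero subspace, obtained by minimising among the
  sublinear functionals below \<open>p\<close> instead of extending along subspaces.
\<close>

theorem linear_functional_below_sublinear:
  assumes W: "function_subspace W" and p: "sublinear_on W p"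
  shows "\<exists>L. linear_functional_on W L \<and> (\<forall>w\<in>W. L w \<le> p w)"
proof -
  define A where "A = {q. sublinear_on W q \<and> (\<forall>w. w \<notin> W \<longrightarrow> q w = 0) \<and> (\<forall>w\<in>W. q w \<le> p w)}"
  \<comment> \<open>Zorn's lemma yields maximal elements, hence the reversed order.\<close>
  define P where "P = (\<lambda>q r :: ('a \<Rightarrow> real) \<Rightarrow> real. \<forall>w. r w \<le> q w)"
  have "\<exists>q\<in>A. \<forall>r\<in>A. P q r \<longrightarrow> r = q"
  proof (rule predicate_Zorn)
    show "partial_order_on A (relation_of P A)"
      by (rule partial_order_on_relation_ofI) (auto simp: P_def fun_eq_iff intro: order_trans antisym)
  next
    fix C assume "C \<in> Chains (relation_of P A)"
    then have CA: "C \<subseteq> A" and chain: "\<And>q r. q \<in> C \<Longrightarrow> r \<in> C \<Longrightarrow> P q r \<or> P r q"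
      by (auto simp: Chains_def relation_of_def)
    show "\<exists>u\<in>A. \<forall>q\<in>C. P q u"
    proof (cases "C = {}")
      case True
      define p0 where "p0 = (\<lambda>w. if w \<in> W then p w else 0)"
      have "p0 \<in> A"
        using p function_subspaceD[OF W] unfolding A_def sublinear_on_def by (auto simp: p0_def)
      then show ?thesis using True by blast
    next
      case False
      define m where "m = (\<lambda>w. if w \<in> W then (INF q\<in>C. q w) else 0)"
      have "sublinear_on W m" and le: "\<And>q w. q \<in> C \<Longrightarrow> w \<in> W \<Longrightarrow> m w \<le> q w"
        using sublinear_on_INF_chain[OF W False, of p] CA chain
        unfolding m_def A_def P_def by blast+
      moreover have "m w = 0" if "w \<notin> W" for w using that by (simp add: m_def)
      moreover have "m w \<le> p w" if "w \<in> W" for w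
        using le[OF _ that] False CA that by (fastforce simp: A_def)
      ultimately have "m \<in> A" by (simp add: A_def)
      moreover have "P q m" if "q \<in> C" for q
        unfolding P_def
      proof
        fix w show "m w \<le> q w"
          using le[OF that] that CA by (cases "w \<in> W") (auto simp: m_def A_def)
      qed
      ultimately show ?thesis by blast
    qed
  qed
  then obtain q where q: "q \<in> A" and min: "\<And>r. r \<in> A \<Longrightarrow> P q r \<Longrightarrow> r = q" by blast
  have "linear_functional_on W q"
  proof (rule minimal_sublinear_is_linear[OF W])
    fix r assume r: "sublinear_on W r" "\<And>w. w \<notin> W \<Longrightarrow> r w = 0" "\<And>w. r w \<le> q w"
    then have "r \<in> A" using q order_trans by (fastforce simp: A_def)
    then show "r = q" using min r(3) by (simp add: P_def)
  qed (use q in \<open>auto simp: A_def\<close>)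
  then show ?thesis using q by (auto simp: A_def)
qed

section \<open>Finitely additive couplings\<close>

text \<open>
  Domination by a sum of integrable functions of one variable is what keeps a positive functional
  with prescribed marginals finite.
\<close>

definition marginally_bounded :: "'a measure \<Rightarrow> 'b measure \<Rightarrow> ('a \<times> 'b \<Rightarrow> real) set" where
  "marginally_bounded A B = {w. \<exists>a b. integrable A a \<and> integrable B b \<and>
     (\<forall>x\<in>space A. \<forall>y\<in>space B. \<bar>w (x, y)\<bar> \<le> a x + b y)}"

lemma marginally_boundedI:
  assumes "integrable A a" "integrable B b"
    and "\<And>x y. x \<in> space A \<Longrightarrow> y \<in> space B \<Longrightarrow> \<bar>w (x, y)\<bar> \<le> a x + b y"
  shows "w \<in> marginally_bounded A B"
  using assms by (auto simp: marginally_bounded_def)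

lemma function_subspace_marginally_bounded: "function_subspace (marginally_bounded A B)"
  unfolding function_subspace_def
proof (intro conjI ballI allI)
  show "(\<lambda>_. 0) \<in> marginally_bounded A B"
    by (rule marginally_boundedI[of _ "\<lambda>_. 0" _ "\<lambda>_. 0"]) auto
next
  fix u v assume "u \<in> marginally_bounded A B" "v \<in> marginally_bounded A B"
  then obtain a b a' b' where *: "integrable A a" "integrable B b" "integrable A a'" "integrable B b'"
    and le: "\<And>x y. x \<in> space A \<Longrightarrow> y \<in> space B \<Longrightarrow> \<bar>u (x, y)\<bar> \<le> a x + b y"
      "\<And>x y. x \<in> space A \<Longrightarrow> y \<in> space B \<Longrightarrow> \<bar>v (x, y)\<bar> \<le> a' x + b' y"
    by (auto simp: marginally_bounded_def)
  show "(\<lambda>z. u z + v z) \<in> marginally_bounded A B"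
  proof (rule marginally_boundedI)
    show "integrable A (\<lambda>x. a x + a' x)" "integrable B (\<lambda>y. b y + b' y)" using * by auto
    fix x y assume xy: "x \<in> space A" "y \<in> space B"
    show "\<bar>u (x, y) + v (x, y)\<bar> \<le> a x + a' x + (b y + b' y)"
      using le(1)[OF xy] le(2)[OF xy] by linarith
  qed
next
  fix c and u assume "u \<in> marginally_bounded A B"
  then obtain a b where *: "integrable A a" "integrable B b"
    and le: "\<And>x y. x \<in> space A \<Longrightarrow> y \<in> space B \<Longrightarrow> \<bar>u (x, y)\<bar> \<le> a x + b y"
    by (auto simp: marginally_bounded_def)
  show "(\<lambda>z. c * u z) \<in> marginally_bounded A B"
  proof (rule marginally_boundedI)
    show "integrable A (\<lambda>x. \<bar>c\<bar> * a x)" "integrable B (\<lambda>y. \<bar>c\<bar> * b y)" using * by auto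
    fix x y assume xy: "x \<in> space A" "y \<in> space B"
    show "\<bar>c * u (x, y)\<bar> \<le> \<bar>c\<bar> * a x + \<bar>c\<bar> * b y"
      using mult_left_mono[OF le[OF xy], of "\<bar>c\<bar>"] by (simp add: abs_mult distrib_left)
  qed
qed

text \<open>
  A coupling of \<open>A\<close> and \<open>B\<close>, in the weak sense of a positive linear functional on functions of two
  variables with prescribed values on functions of one variable.  Such functionals come directly
  out of the extension principle, for arbitrary measurable spaces, and suffice to build an operator.
\<close>

locale coupling_functional = X: finite_measure A + Y: finite_measure B
  for A :: "'a measure" and B :: "'b measure" +
  fixes \<Lambda> :: "('a \<times> 'b \<Rightarrow> real) \<Rightarrow> real"
  assumes linear: "linear_functional_on (marginally_bounded A B) \<Lambda>"
    and nonneg: "w \<in> marginally_bounded A B \<Longrightarrow>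
      (\<And>x y. x \<in> space A \<Longrightarrow> y \<in> space B \<Longrightarrow> 0 \<le> w (x, y)) \<Longrightarrow> 0 \<le> \<Lambda> w"
    and left_marginal: "integrable A a \<Longrightarrow> \<Lambda> (\<lambda>z. a (fst z)) = (\<integral>x. a x \<partial>A)"
    and right_marginal: "integrable B b \<Longrightarrow> \<Lambda> (\<lambda>z. b (snd z)) = (\<integral>y. b y \<partial>B)"

section \<open>Duality for martingale couplings\<close>

text \<open>
  Only those \<open>\<psi>\<close> with both compositions integrable are tested, so that ordinary integrals suffice; the
  functions \<open>\<psi>\<close> used below have linear growth.
\<close>

locale convex_dominated = X: finite_measure A + Y: finite_measure B
  for A :: "'a measure" and B :: "'b measure" +
  fixes F :: "'a \<Rightarrow> real" and G :: "'b \<Rightarrow> real"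
  assumes F_int: "integrable A F" and G_int: "integrable B G"
    and nonempty: "space A \<noteq> {}" "space B \<noteq> {}"
    and dominated: "convex_on UNIV \<psi> \<Longrightarrow> integrable A (\<lambda>x. \<psi> (F x)) \<Longrightarrow>
      integrable B (\<lambda>y. \<psi> (G y)) \<Longrightarrow> (\<integral>x. \<psi> (F x) \<partial>A) \<le> (\<integral>y. \<psi> (G y) \<partial>B)"
begin

text \<open>
  In the language of mathematical finance, the claim \<open>w\<close> is dominated by static positions \<open>a\<close> in \<open>x\<close> and
  \<open>b\<close> in \<open>y\<close> together with \<open>c x\<close> units of the increment \<open>G y - F x\<close>, whose conditional mean given \<open>x\<close> is
  zero under a martingale coupling.  The position \<open>c\<close> is required to be bounded in order to keep the
  convex function of \<open>no_arbitrage\<close> Lipschitz, hence finite on the whole line.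
\<close>

definition superhedges :: "('a \<times> 'b \<Rightarrow> real) \<Rightarrow> ('a \<Rightarrow> real) \<Rightarrow> ('b \<Rightarrow> real) \<Rightarrow> bool" where
  "superhedges w a b \<longleftrightarrow> integrable A a \<and> integrable B b \<and>
     (\<exists>c C. (\<forall>x. \<bar>c x\<bar> \<le> C) \<and>
       (\<forall>x\<in>space A. \<forall>y\<in>space B. w (x, y) \<le> a x + b y + c x * (G y - F x)))"

lemma superhedgesI:
  assumes "integrable A a" "integrable B b" "\<And>x. \<bar>c x\<bar> \<le> C"
    and "\<And>x y. x \<in> space A \<Longrightarrow> y \<in> space B \<Longrightarrow> w (x, y) \<le> a x + b y + c x * (G y - F x)"
  shows "superhedges w a b"
  using assms unfolding superhedges_def by blast

lemma superhedges_staticI: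
  assumes "integrable A a" "integrable B b"
    and "\<And>x y. x \<in> space A \<Longrightarrow> y \<in> space B \<Longrightarrow> w (x, y) \<le> a x + b y"
  shows "superhedges w a b"
  using assms by (intro superhedgesI[where c = "\<lambda>_. 0" and C = 0]) auto

lemma superhedgesE:
  assumes "superhedges w a b"
  obtains c C where "integrable A a" "integrable B b" "\<And>x. \<bar>c x\<bar> \<le> C"
    and "\<And>x y. x \<in> space A \<Longrightarrow> y \<in> space B \<Longrightarrow> w (x, y) \<le> a x + b y + c x * (G y - F x)"
  using assms unfolding superhedges_def by blast

definition price :: "('a \<times> 'b \<Rightarrow> real) \<Rightarrow> real" where
  "price w = Inf {(\<integral>x. a x \<partial>A) + (\<integral>y. b y \<partial>B) | a b. superhedges w a b}"

text \<open>
  This is where the convex order is used.  If \<open>0 \<le> a x + b y + c x * (G y - F x)\<close> everywhere, then the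
  affine functions \<open>t \<mapsto> - a x - c x * (t - F x)\<close> lie below \<open>b y\<close> at \<open>t = G y\<close> and take the value
  \<open>- a x\<close> at \<open>t = F x\<close>.  Their supremum \<open>\<psi>\<close> is a convex function with \<open>- a \<le> \<psi> \<circ> F\<close> and \<open>\<psi> \<circ> G \<le> b\<close>, so
  \<open>- \<integral>a \<le> \<integral>\<psi> \<circ> F \<le> \<integral>\<psi> \<circ> G \<le> \<integral>b\<close>.
\<close>

lemma no_arbitrage:
  assumes "superhedges (\<lambda>_. 0) a b"
  shows "0 \<le> (\<integral>x. a x \<partial>A) + (\<integral>y. b y \<partial>B)"
proof -
  obtain c C where ab: "integrable A a" "integrable B b" and c: "\<And>x. \<bar>c x\<bar> \<le> C"
    and hedge: "\<And>x y. x \<in> space A \<Longrightarrow> y \<in> space B \<Longrightarrow> 0 \<le> a x + b y + c x * (G y - F x)"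
    using superhedgesE[OF assms] by metis
  obtain x0 y0 where x0: "x0 \<in> space A" and y0: "y0 \<in> space B" using nonempty by blast
  define line where "line x t = - a x - c x * (t - F x)" for x t
  define \<psi> where "\<psi> t = (SUP x\<in>space A. line x t)" for t
  \<comment> \<open>Since the slopes are bounded, one point \<open>y0\<close> controls the supremum at every \<open>t\<close>.\<close>
  have line_bound: "line x t \<le> b y0 + C * \<bar>t - G y0\<bar>" if x: "x \<in> space A" for x t
  proof -
    have "line x t = (- a x - c x * (G y0 - F x)) + (- c x) * (t - G y0)"
      by (simp add: line_def algebra_simps)
    moreover have "(- c x) * (t - G y0) \<le> C * \<bar>t - G y0\<bar>"
    proof -
      have "(- c x) * (t - G y0) \<le> \<bar>c x\<bar> * \<bar>t - G y0\<bar>" by (metis abs_ge_self abs_minus abs_mult)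
      also have "\<dots> \<le> C * \<bar>t - G y0\<bar>" using c by (intro mult_right_mono) auto
      finally show ?thesis .
    qed
    ultimately show ?thesis using hedge[OF x y0] by linarith
  qed
  then have bdd: "bdd_above ((\<lambda>x. line x t) ` space A)" for t by (auto intro!: bdd_aboveI2)
  have \<psi>_upper: "line x t \<le> \<psi> t" if "x \<in> space A" for x t
    unfolding \<psi>_def using that bdd by (intro cSUP_upper) auto
  have \<psi>_least: "\<psi> t \<le> m" if "\<And>x. x \<in> space A \<Longrightarrow> line x t \<le> m" for t m
    unfolding \<psi>_def using that nonempty by (intro cSUP_least) auto
  have convex: "convex_on UNIV \<psi>"
  proof (rule convex_onI)
    fix t u v :: real assume t: "0 < t" "t < 1"
    show "\<psi> ((1 - t) *\<^sub>R u + t *\<^sub>R v) \<le> (1 - t) * \<psi> u + t * \<psi> v"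
    proof (rule \<psi>_least)
      fix x assume x: "x \<in> space A"
      have "line x ((1 - t) *\<^sub>R u + t *\<^sub>R v) = (1 - t) * line x u + t * line x v"
        by (simp add: line_def algebra_simps)
      also have "\<dots> \<le> (1 - t) * \<psi> u + t * \<psi> v"
        using \<psi>_upper[OF x] t by (intro add_mono mult_left_mono) auto
      finally show "line x ((1 - t) *\<^sub>R u + t *\<^sub>R v) \<le> (1 - t) * \<psi> u + t * \<psi> v" .
    qed
  qed auto
  have [measurable]: "\<psi> \<in> borel_measurable borel"
    using convex_on_continuous[OF open_UNIV convex] by (rule borel_measurable_continuous_onI)
  \<comment> \<open>Linear growth makes \<open>\<psi>\<close> integrable along \<open>F\<close> and \<open>G\<close>.\<close>
  have growth: "\<bar>\<psi> t\<bar> \<le> (\<bar>b y0\<bar> + C * \<bar>G y0\<bar> + \<bar>a x0\<bar> + C * \<bar>F x0\<bar>) + C * \<bar>t\<bar>" for t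
  proof -
    have C: "0 \<le> C" using c[of x0] by simp
    have "\<psi> t \<le> b y0 + C * \<bar>t - G y0\<bar>" using line_bound by (intro \<psi>_least) auto
    also have "C * \<bar>t - G y0\<bar> \<le> C * (\<bar>t\<bar> + \<bar>G y0\<bar>)" using C by (intro mult_left_mono) auto
    finally have upper: "\<psi> t \<le> \<bar>b y0\<bar> + C * \<bar>t\<bar> + C * \<bar>G y0\<bar>" by (simp add: distrib_left)
    have "c x0 * (t - F x0) \<le> \<bar>c x0\<bar> * \<bar>t - F x0\<bar>" by (metis abs_ge_self abs_mult)
    also have "\<dots> \<le> C * (\<bar>t\<bar> + \<bar>F x0\<bar>)" using c C by (intro mult_mono) auto
    finally have "- (\<bar>a x0\<bar> + C * \<bar>t\<bar> + C * \<bar>F x0\<bar>) \<le> line x0 t"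
      by (simp add: line_def distrib_left)
    then have lower: "- (\<bar>a x0\<bar> + C * \<bar>t\<bar> + C * \<bar>F x0\<bar>) \<le> \<psi> t" using \<psi>_upper[OF x0, of t] by simp
    have "0 \<le> C * \<bar>G y0\<bar>" "0 \<le> C * \<bar>F x0\<bar>" using C by auto
    with upper lower show ?thesis by linarith
  qed
  have F_\<psi>: "integrable A (\<lambda>x. \<psi> (F x))"
  proof (rule Bochner_Integration.integrable_bound)
    show "integrable A (\<lambda>x. (\<bar>b y0\<bar> + C * \<bar>G y0\<bar> + \<bar>a x0\<bar> + C * \<bar>F x0\<bar>) + C * \<bar>F x\<bar>)"
      using F_int by auto
    show "AE x in A. norm (\<psi> (F x)) \<le> norm ((\<bar>b y0\<bar> + C * \<bar>G y0\<bar> + \<bar>a x0\<bar> + C * \<bar>F x0\<bar>) + C * \<bar>F x\<bar>)"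
      using growth by (intro AE_I2) (metis abs_ge_self order_trans real_norm_def)
  qed (use F_int in measurable)
  have G_\<psi>: "integrable B (\<lambda>y. \<psi> (G y))"
  proof (rule Bochner_Integration.integrable_bound)
    show "integrable B (\<lambda>y. (\<bar>b y0\<bar> + C * \<bar>G y0\<bar> + \<bar>a x0\<bar> + C * \<bar>F x0\<bar>) + C * \<bar>G y\<bar>)"
      using G_int by auto
    show "AE y in B. norm (\<psi> (G y)) \<le> norm ((\<bar>b y0\<bar> + C * \<bar>G y0\<bar> + \<bar>a x0\<bar> + C * \<bar>F x0\<bar>) + C * \<bar>G y\<bar>)"
      using growth by (intro AE_I2) (metis abs_ge_self order_trans real_norm_def)
  qed (use G_int in measurable)
  have "- (\<integral>x. a x \<partial>A) = (\<integral>x. - a x \<partial>A)" by simp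
  also have "\<dots> \<le> (\<integral>x. \<psi> (F x) \<partial>A)"
  proof (rule integral_mono)
    show "- a x \<le> \<psi> (F x)" if "x \<in> space A" for x using \<psi>_upper[OF that, of "F x"] by (simp add: line_def)
  qed (use ab F_\<psi> in auto)
  also have "\<dots> \<le> (\<integral>y. \<psi> (G y) \<partial>B)" by (rule dominated[OF convex F_\<psi> G_\<psi>])
  also have "\<dots> \<le> (\<integral>y. b y \<partial>B)"
  proof (rule integral_mono[OF G_\<psi> ab(2)])
    fix y assume y: "y \<in> space B"
    show "\<psi> (G y) \<le> b y"
    proof (rule \<psi>_least)
      fix x assume "x \<in> space A"
      then show "line x (G y) \<le> b y" using hedge[OF _ y] by (fastforce simp: line_def)
    qed
  qed
  finally show ?thesis by simp
qed

lemma superhedges_add: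
  assumes "superhedges u a b" "superhedges v a' b'"
  shows "superhedges (\<lambda>z. u z + v z) (\<lambda>x. a x + a' x) (\<lambda>y. b y + b' y)"
proof -
  obtain c C where 1: "integrable A a" "integrable B b" and c: "\<And>x. \<bar>c x\<bar> \<le> C"
    and u: "\<And>x y. x \<in> space A \<Longrightarrow> y \<in> space B \<Longrightarrow> u (x, y) \<le> a x + b y + c x * (G y - F x)"
    using superhedgesE[OF assms(1)] by metis
  obtain c' C' where 2: "integrable A a'" "integrable B b'" and c': "\<And>x. \<bar>c' x\<bar> \<le> C'"
    and v: "\<And>x y. x \<in> space A \<Longrightarrow> y \<in> space B \<Longrightarrow> v (x, y) \<le> a' x + b' y + c' x * (G y - F x)"
    using superhedgesE[OF assms(2)] by metis
  show ?thesis
  proof (rule superhedgesI)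
    show "\<bar>c x + c' x\<bar> \<le> C + C'" for x using c[of x] c'[of x] by linarith
    fix x y assume xy: "x \<in> space A" "y \<in> space B"
    show "u (x, y) + v (x, y) \<le> a x + a' x + (b y + b' y) + (c x + c' x) * (G y - F x)"
      using u[OF xy] v[OF xy] unfolding distrib_right by linarith
  qed (use 1 2 in auto)
qed

lemma superhedges_scale:
  assumes "superhedges u a b" "0 \<le> s"
  shows "superhedges (\<lambda>z. s * u z) (\<lambda>x. s * a x) (\<lambda>y. s * b y)"
proof -
  obtain c C where 1: "integrable A a" "integrable B b" and c: "\<And>x. \<bar>c x\<bar> \<le> C"
    and u: "\<And>x y. x \<in> space A \<Longrightarrow> y \<in> space B \<Longrightarrow> u (x, y) \<le> a x + b y + c x * (G y - F x)"
    using superhedgesE[OF assms(1)] by metis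
  show ?thesis
  proof (rule superhedgesI)
    show "\<bar>s * c x\<bar> \<le> s * C" for x using c[of x] assms(2) by (simp add: abs_mult mult_left_mono)
    fix x y assume xy: "x \<in> space A" "y \<in> space B"
    show "s * u (x, y) \<le> s * a x + s * b y + s * c x * (G y - F x)"
      using mult_left_mono[OF u[OF xy] assms(2)] by (simp add: algebra_simps)
  qed (use 1 in auto)
qed

lemma superhedges_marginally_bounded:
  assumes "w \<in> marginally_bounded A B"
  obtains a b where "superhedges w a b" "superhedges (\<lambda>z. - w z) a b"
proof -
  obtain a b where "integrable A a" "integrable B b"
    and le: "\<And>x y. x \<in> space A \<Longrightarrow> y \<in> space B \<Longrightarrow> \<bar>w (x, y)\<bar> \<le> a x + b y"
    using assms by (auto simp: marginally_bounded_def)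
  then have "superhedges w a b" "superhedges (\<lambda>z. - w z) a b"
    using le by (auto intro!: superhedges_staticI simp: abs_le_iff)
  then show thesis by (rule that)
qed

text \<open>
  The costs of superhedging \<open>w\<close> are bounded below: adding a fixed superhedge of \<open>- w\<close> gives a superhedge
  of zero, whose cost is nonnegative.
\<close>

lemma price_le:
  assumes w: "w \<in> marginally_bounded A B" and hedge: "superhedges w a b"
  shows "price w \<le> (\<integral>x. a x \<partial>A) + (\<integral>y. b y \<partial>B)"
proof -
  obtain a0 b0 where 0: "superhedges (\<lambda>z. - w z) a0 b0"
    using superhedges_marginally_bounded[OF w] by metis
  have "- ((\<integral>x. a0 x \<partial>A) + (\<integral>y. b0 y \<partial>B)) \<le> (\<integral>x. a x \<partial>A) + (\<integral>y. b y \<partial>B)"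
    if "superhedges w a b" for a b
  proof -
    have "superhedges (\<lambda>_. 0) (\<lambda>x. a x + a0 x) (\<lambda>y. b y + b0 y)"
      using superhedges_add[OF that 0] by simp
    from no_arbitrage[OF this] show ?thesis
      using that 0 by (auto simp: superhedges_def)
  qed
  then have "bdd_below {(\<integral>x. a x \<partial>A) + (\<integral>y. b y \<partial>B) | a b. superhedges w a b}"
    by (intro bdd_belowI) blast
  then show ?thesis unfolding price_def using hedge by (intro cInf_lower) auto
qed

lemma price_greatest:
  assumes w: "w \<in> marginally_bounded A B"
    and le: "\<And>a b. superhedges w a b \<Longrightarrow> m \<le> (\<integral>x. a x \<partial>A) + (\<integral>y. b y \<partial>B)"
  shows "m \<le> price w"
  unfolding price_def
proof (rule cInf_greatest)
  show "{(\<integral>x. a x \<partial>A) + (\<integral>y. b y \<partial>B) | a b. superhedges w a b} \<noteq> {}"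
  proof -
    obtain a b where "superhedges w a b" by (rule superhedges_marginally_bounded[OF w])
    then show ?thesis by blast
  qed
qed (use le in auto)

lemma sublinear_on_price: "sublinear_on (marginally_bounded A B) price"
proof -
  note W_closed = function_subspaceD[OF function_subspace_marginally_bounded]
  show ?thesis
    unfolding sublinear_on_def
  proof (intro conjI ballI allI impI)
    fix u v assume uv: "u \<in> marginally_bounded A B" "v \<in> marginally_bounded A B"
    have *: "price (\<lambda>z. u z + v z) \<le>
        ((\<integral>x. a x \<partial>A) + (\<integral>y. b y \<partial>B)) + ((\<integral>x. a' x \<partial>A) + (\<integral>y. b' y \<partial>B))"
      if "superhedges u a b" "superhedges v a' b'" for a b a' b'
      using price_le[OF W_closed(2)[OF uv] superhedges_add[OF that]] that
      by (simp add: superhedges_def)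
    have "price (\<lambda>z. u z + v z) - ((\<integral>x. a' x \<partial>A) + (\<integral>y. b' y \<partial>B)) \<le> price u"
      if "superhedges v a' b'" for a' b'
      using *[OF _ that] by (intro price_greatest uv) (simp add: algebra_simps)
    then have "price (\<lambda>z. u z + v z) - price u \<le> price v"
      by (intro price_greatest uv) (simp add: algebra_simps)
    then show "price (\<lambda>z. u z + v z) \<le> price u + price v" by simp
  next
    fix c :: real and u assume c: "0 \<le> c" and u: "u \<in> marginally_bounded A B"
    have *: "price (\<lambda>z. c * u z) \<le> c * ((\<integral>x. a x \<partial>A) + (\<integral>y. b y \<partial>B))" if "superhedges u a b" for a b
      using price_le[OF W_closed(3)[OF u] superhedges_scale[OF that c]] by (simp add: distrib_left)
    show "price (\<lambda>z. c * u z) \<le> c * price u"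
    proof (cases "c = 0")
      case True
      then show ?thesis using * superhedges_marginally_bounded[OF u] by (metis mult_zero_left)
    next
      case False
      with c have c: "c > 0" by simp
      have "price (\<lambda>z. c * u z) / c \<le> price u"
        using * c by (intro price_greatest u) (simp add: field_simps)
      then show ?thesis using c by (simp add: field_simps)
    qed
  qed
qed

text \<open>
  A linear functional below \<open>price\<close> is automatically a coupling functional: each required identity
  concerns a function \<open>w\<close> such that \<open>w\<close> and \<open>- w\<close> have superhedges of opposite costs, and positivity holds
  because \<open>- w \<le> 0\<close> is superhedged by zero.  The vanishing on \<open>1\<^sub>S(x) (G y - F x)\<close> comes from the
  superhedge with \<open>c = \<plusminus> 1\<^sub>S\<close>, and will say that the operator defined by \<open>\<Lambda>\<close> maps \<open>G\<close> to \<open>F\<close>.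
\<close>

theorem martingale_coupling_functional:
  "\<exists>\<Lambda>. coupling_functional A B \<Lambda> \<and>
    (\<forall>S. \<Lambda> (\<lambda>z. indicator S (fst z) * (G (snd z) - F (fst z))) = 0)"
proof -
  let ?W = "marginally_bounded A B"
  note subspace = function_subspace_marginally_bounded[of A B]
  note W_closed = function_subspaceD[OF subspace]
  obtain \<Lambda> where lin: "linear_functional_on ?W \<Lambda>" and below: "\<And>w. w \<in> ?W \<Longrightarrow> \<Lambda> w \<le> price w"
    using linear_functional_below_sublinear[OF subspace sublinear_on_price] by blast
  have neg: "\<Lambda> (\<lambda>z. - w z) = - \<Lambda> w" if "w \<in> ?W" for w
  proof -
    have "\<Lambda> (\<lambda>z. - 1 * w z) = - 1 * \<Lambda> w" using lin that unfolding linear_functional_on_def by blast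
    then show ?thesis by simp
  qed
  have le: "\<Lambda> w \<le> (\<integral>x. a x \<partial>A) + (\<integral>y. b y \<partial>B)" if "w \<in> ?W" "superhedges w a b" for w a b
    using below[OF that(1)] price_le[OF that] by simp
  have ge: "- ((\<integral>x. a x \<partial>A) + (\<integral>y. b y \<partial>B)) \<le> \<Lambda> w" if "w \<in> ?W" "superhedges (\<lambda>z. - w z) a b" for w a b
  proof -
    have "(\<lambda>z. - w z) \<in> ?W" using W_closed(3)[OF that(1), of "- 1"] by simp
    from le[OF this that(2)] neg[OF that(1)] show ?thesis by linarith
  qed
  have "coupling_functional A B \<Lambda>"
  proof unfold_locales
    show "linear_functional_on ?W \<Lambda>" by (rule lin)
  next
    fix w assume w: "w \<in> ?W" and pos: "\<And>x y. x \<in> space A \<Longrightarrow> y \<in> space B \<Longrightarrow> 0 \<le> w (x, y)"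
    have "superhedges (\<lambda>z. - w z) (\<lambda>_. 0) (\<lambda>_. 0)" using pos by (intro superhedges_staticI) auto
    from ge[OF w this] show "0 \<le> \<Lambda> w" by simp
  next
    fix a :: "'a \<Rightarrow> real" assume a: "integrable A a"
    then have W: "(\<lambda>z. a (fst z)) \<in> ?W"
      by (intro marginally_boundedI[of _ "\<lambda>x. \<bar>a x\<bar>" _ "\<lambda>_. 0"]) auto
    have "superhedges (\<lambda>z. a (fst z)) a (\<lambda>_. 0)" "superhedges (\<lambda>z. - a (fst z)) (\<lambda>x. - a x) (\<lambda>_. 0)"
      using a by (auto intro!: superhedges_staticI)
    with le[OF W this(1)] ge[OF W this(2)] show "\<Lambda> (\<lambda>z. a (fst z)) = (\<integral>x. a x \<partial>A)" by simp
  next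
    fix b :: "'b \<Rightarrow> real" assume b: "integrable B b"
    then have W: "(\<lambda>z. b (snd z)) \<in> ?W"
      by (intro marginally_boundedI[of _ "\<lambda>_. 0" _ "\<lambda>y. \<bar>b y\<bar>"]) auto
    have "superhedges (\<lambda>z. b (snd z)) (\<lambda>_. 0) b" "superhedges (\<lambda>z. - b (snd z)) (\<lambda>_. 0) (\<lambda>y. - b y)"
      using b by (auto intro!: superhedges_staticI)
    with le[OF W this(1)] ge[OF W this(2)] show "\<Lambda> (\<lambda>z. b (snd z)) = (\<integral>y. b y \<partial>B)" by simp
  qed
  moreover have "\<Lambda> (\<lambda>z. indicator S (fst z) * (G (snd z) - F (fst z))) = 0" for S
  proof -
    let ?w = "\<lambda>z. indicator S (fst z) * (G (snd z) - F (fst z))"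
    have W: "?w \<in> ?W"
      using F_int G_int
      by (intro marginally_boundedI[of _ "\<lambda>x. \<bar>F x\<bar>" _ "\<lambda>y. \<bar>G y\<bar>"]) (auto simp: indicator_def)
    have "superhedges ?w (\<lambda>_. 0) (\<lambda>_. 0)"
      by (rule superhedgesI[where c = "indicator S" and C = 1]) (auto simp: indicator_def)
    moreover have "superhedges (\<lambda>z. - ?w z) (\<lambda>_. 0) (\<lambda>_. 0)"
      by (rule superhedgesI[where c = "\<lambda>x. - indicator S x" and C = 1]) (auto simp: indicator_def)
    ultimately show ?thesis using le[OF W, of "\<lambda>_. 0" "\<lambda>_. 0"] ge[OF W, of "\<lambda>_. 0" "\<lambda>_. 0"] by simp
  qed
  ultimately show ?thesis by blast
qed

end

section \<open>The doubly stochastic operator of a coupling functional\<close>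

lemma tail_integral_tendsto_0:
  fixes u :: "'b \<Rightarrow> real"
  assumes u: "integrable B u"
  shows "(\<lambda>n. \<integral>y. max 0 (u y - real n) \<partial>B) \<longlonglongrightarrow> 0"
proof -
  have "(\<lambda>n. \<integral>y. max 0 (u y - real n) \<partial>B) \<longlonglongrightarrow> (\<integral>y. 0 \<partial>B)"
  proof (rule integral_dominated_convergence[where w = "\<lambda>y. \<bar>u y\<bar>"])
    show "AE y in B. (\<lambda>n. max 0 (u y - real n)) \<longlonglongrightarrow> 0"
    proof (rule AE_I2)
      fix y
      obtain m :: nat where "u y \<le> real m" using real_arch_simple by blast
      then have "eventually (\<lambda>n. max 0 (u y - real n) = 0) sequentially"
        by (auto simp: eventually_sequentially max_def intro!: exI[of _ m])
      then show "(\<lambda>n. max 0 (u y - real n)) \<longlonglongrightarrow> 0" by (rule tendsto_eventually)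
    qed
  qed (use u in auto)
  then show ?thesis by simp
qed

context coupling_functional
begin

text \<open>
  For a genuine coupling \<open>\<pi>\<close> this is \<open>\<integral>\<^bsub>S\<times>Y\<^esub> u(y) d\<pi>\<close>, the integral over \<open>S\<close> of the conditional
  expectation of \<open>u(y)\<close> given \<open>x\<close>.  The operator will be its density in \<open>S\<close>.
\<close>

definition localized :: "'a set \<Rightarrow> ('b \<Rightarrow> real) \<Rightarrow> real" where
  "localized S u = \<Lambda> (\<lambda>z. indicator S (fst z) * u (snd z))"

lemma localized_in_domain:
  assumes "integrable B u"
  shows "(\<lambda>z. indicator S (fst z) * u (snd z)) \<in> marginally_bounded A B"
  using assms
  by (intro marginally_boundedI[of _ "\<lambda>_. 0" _ "\<lambda>y. \<bar>u y\<bar>"]) (auto simp: indicator_def)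

lemma \<Lambda>_add:
  assumes "u \<in> marginally_bounded A B" "v \<in> marginally_bounded A B"
  shows "\<Lambda> (\<lambda>z. u z + v z) = \<Lambda> u + \<Lambda> v"
  using linear assms unfolding linear_functional_on_def by blast

lemma \<Lambda>_scale:
  assumes "u \<in> marginally_bounded A B"
  shows "\<Lambda> (\<lambda>z. c * u z) = c * \<Lambda> u"
  using linear assms unfolding linear_functional_on_def by blast

lemma \<Lambda>_mono:
  assumes u: "u \<in> marginally_bounded A B" and v: "v \<in> marginally_bounded A B"
    and le: "\<And>x y. x \<in> space A \<Longrightarrow> y \<in> space B \<Longrightarrow> u (x, y) \<le> v (x, y)"
  shows "\<Lambda> u \<le> \<Lambda> v"
proof -
  note W_closed = function_subspaceD[OF function_subspace_marginally_bounded[of A B]]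
  have "0 \<le> \<Lambda> (\<lambda>z. v z + - 1 * u z)"
    using le by (intro nonneg W_closed u v) auto
  also have "\<dots> = \<Lambda> v + - 1 * \<Lambda> u"
    using \<Lambda>_add[OF v W_closed(3)[OF u, of "- 1"]] \<Lambda>_scale[OF u, of "- 1"] by simp
  finally show ?thesis by simp
qed

lemma localized_add:
  assumes "integrable B u" "integrable B v"
  shows "localized S (\<lambda>y. u y + v y) = localized S u + localized S v"
  using \<Lambda>_add[OF localized_in_domain[OF assms(1)] localized_in_domain[OF assms(2)]]
  by (simp add: localized_def distrib_left)

lemma localized_scale:
  assumes "integrable B u"
  shows "localized S (\<lambda>y. c * u y) = c * localized S u"
  using \<Lambda>_scale[OF localized_in_domain[OF assms], of c]
  by (simp add: localized_def mult.left_commute)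

lemma localized_nonneg:
  assumes "integrable B u" "\<And>y. y \<in> space B \<Longrightarrow> 0 \<le> u y"
  shows "0 \<le> localized S u"
  using assms unfolding localized_def by (intro nonneg localized_in_domain) auto

lemma localized_space:
  assumes "integrable B u"
  shows "localized (space A) u = (\<integral>y. u y \<partial>B)"
proof -
  have "(\<lambda>z. u (snd z)) \<in> marginally_bounded A B"
    using assms by (intro marginally_boundedI[of _ "\<lambda>_. 0" _ "\<lambda>y. \<bar>u y\<bar>"]) auto
  then have "localized (space A) u = \<Lambda> (\<lambda>z. u (snd z))"
    unfolding localized_def by (intro antisym \<Lambda>_mono localized_in_domain assms) auto
  then show ?thesis using right_marginal[OF assms] by simp
qed

lemma localized_one:
  assumes "S \<in> sets A"
  shows "localized S (\<lambda>_. 1) = measure A S"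
proof -
  have "integrable A (indicator S :: 'a \<Rightarrow> real)"
    using assms by (simp add: integrable_indicator_iff X.emeasure_finite less_top[symmetric])
  from left_marginal[OF this] show ?thesis using assms by (simp add: localized_def)
qed

lemma localized_Un:
  assumes "integrable B u" "S \<inter> T = {}"
  shows "localized (S \<union> T) u = localized S u + localized T u"
proof -
  have "(\<lambda>z. indicator (S \<union> T) (fst z) * u (snd z)) =
      (\<lambda>z. indicator S (fst z) * u (snd z) + indicator T (fst z) * u (snd z))"
    using assms(2) by (auto simp: indicator_def fun_eq_iff)
  then show ?thesis
    using \<Lambda>_add[OF localized_in_domain[OF assms(1)] localized_in_domain[OF assms(1)], of S T]
    by (simp add: localized_def)
qed

lemma localized_abs_le:
  assumes u: "integrable B u"
  shows "\<bar>localized S u\<bar> \<le> (\<integral>y. \<bar>u y\<bar> \<partial>B)"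
proof -
  have *: "localized S v \<le> (\<integral>y. \<bar>v y\<bar> \<partial>B)" if v: "integrable B v" for v
  proof -
    have "localized S v \<le> localized (space A) (\<lambda>y. \<bar>v y\<bar>)"
      unfolding localized_def using v
      by (intro \<Lambda>_mono localized_in_domain) (auto simp: indicator_def)
    then show ?thesis using localized_space[of "\<lambda>y. \<bar>v y\<bar>"] v by simp
  qed
  show ?thesis
    using *[OF u] *[of "\<lambda>y. - 1 * u y"] localized_scale[OF u, of S "- 1"] u by simp
qed

lemma localized_cong_AE:
  assumes u: "integrable B u" and v: "integrable B v" and eq: "AE y in B. u y = v y"
  shows "localized S u = localized S v"
proof -
  have "localized S (\<lambda>y. u y + - 1 * v y) = localized S u - localized S v"
    using localized_add[OF u, of "\<lambda>y. - 1 * v y" S] localized_scale[OF v, of S "- 1"] v by simp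
  moreover have "\<bar>localized S (\<lambda>y. u y + - 1 * v y)\<bar> \<le> (\<integral>y. \<bar>u y + - 1 * v y\<bar> \<partial>B)"
    using u v by (intro localized_abs_le) auto
  moreover have "(\<integral>y. \<bar>u y + - 1 * v y\<bar> \<partial>B) = 0"
  proof -
    have "AE y in B. \<bar>u y + - 1 * v y\<bar> = 0" using eq by auto
    then show ?thesis by (rule integral_eq_zero_AE)
  qed
  ultimately show ?thesis by simp
qed

text \<open>
  Splitting \<open>u \<le> c + (u - c)\<^sup>+\<close> makes the first part small with \<open>S\<close> and the second small
  for large \<open>c\<close>, uniformly in \<open>S\<close>.  This uniform integrability supplies the countable additivity that \<open>\<Lambda>\<close>
  itself lacks.
\<close>

lemma localized_truncation:
  assumes u: "integrable B u" and S: "S \<in> sets A" and c: "0 \<le> c"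
  shows "localized S u \<le> c * measure A S + (\<integral>y. max 0 (u y - c) \<partial>B)"
proof -
  have tail: "integrable B (\<lambda>y. max 0 (u y - c))" using u by auto
  have "localized S u \<le> localized S (\<lambda>y. c * 1 + max 0 (u y - c))"
    unfolding localized_def using u by (intro \<Lambda>_mono localized_in_domain) (auto simp: indicator_def)
  also have "\<dots> = c * measure A S + localized S (\<lambda>y. max 0 (u y - c))"
    using tail localized_one[OF S] localized_scale[of "\<lambda>_. 1" S c]
      localized_add[of "\<lambda>_. c * 1" "\<lambda>y. max 0 (u y - c)" S] by simp
  also have "localized S (\<lambda>y. max 0 (u y - c)) \<le> (\<integral>y. \<bar>max 0 (u y - c)\<bar> \<partial>B)"
    using localized_abs_le[OF tail] by (rule abs_le_D1)
  finally show ?thesis by (simp add: algebra_simps)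
qed

lemma localized_continuous_at_empty:
  assumes u: "integrable B u" and pos: "\<And>y. y \<in> space B \<Longrightarrow> 0 \<le> u y"
    and S: "\<And>i. S i \<in> sets A" and lim: "(\<lambda>i. measure A (S i)) \<longlonglongrightarrow> 0"
  shows "(\<lambda>i. localized (S i) u) \<longlonglongrightarrow> 0"
proof (rule LIMSEQ_I)
  fix r :: real assume r: "0 < r"
  obtain n :: nat where n: "(\<integral>y. max 0 (u y - real n) \<partial>B) < r / 2"
    using order_tendstoD(2)[OF tail_integral_tendsto_0[OF u], of "r / 2"] r
    by (auto simp: eventually_sequentially)
  have "(\<lambda>i. real n * measure A (S i)) \<longlonglongrightarrow> 0" using tendsto_mult_right_zero[OF lim] by simp
  then obtain i0 where i0: "\<And>i. i0 \<le> i \<Longrightarrow> real n * measure A (S i) < r / 2"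
    using order_tendstoD(2)[of _ 0 sequentially "r / 2"] r unfolding eventually_sequentially by force
  have "norm (localized (S i) u - 0) < r" if "i0 \<le> i" for i
    using localized_truncation[OF u S, of "real n" i] localized_nonneg[OF u pos, of "S i"] n i0[OF that] by simp
  then show "\<exists>no. \<forall>i\<ge>no. norm (localized (S i) u - 0) < r" by blast
qed

text \<open>
  The set function \<open>S \<mapsto> localized S u\<close> is additive and continuous at the empty set, hence a finite
  measure, and it vanishes on null sets; its Radon--Nikodym derivative is the required function.
\<close>

lemma localized_density_nonneg:
  assumes u: "integrable B u" and pos: "\<And>y. y \<in> space B \<Longrightarrow> 0 \<le> u y"
  shows "\<exists>w. integrable A w \<and> (\<forall>x. 0 \<le> w x) \<and>
    (\<forall>S\<in>sets A. (\<integral>x\<in>S. w x \<partial>A) = localized S u)"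
proof -
  have empty: "localized {} u = 0"
    using localized_Un[OF u, of "{}" "{}"] by simp
  have mu_nonneg: "0 \<le> localized S u" for S using localized_nonneg[OF u pos] .
  define \<mu> where "\<mu> = measure_of (space A) (sets A) (\<lambda>S. ennreal (localized S u))"
  have ca: "countably_additive (sets A) (\<lambda>S. ennreal (localized S u))"
  proof (rule sets.empty_continuous_imp_countably_additive)
    show "positive (sets A) (\<lambda>S. ennreal (localized S u))" by (simp add: positive_def empty)
    show "additive (sets A) (\<lambda>S. ennreal (localized S u))"
      using mu_nonneg by (auto simp: additive_def localized_Un[OF u] simp flip: ennreal_plus)
    fix S :: "nat \<Rightarrow> 'a set" assume S: "range S \<subseteq> sets A" "decseq S" "(\<Inter>i. S i) = {}"
    have "(\<lambda>i. measure A (S i)) \<longlonglongrightarrow> measure A (\<Inter>i. S i)"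
      using S by (intro X.finite_Lim_measure_decseq) auto
    then have "(\<lambda>i. localized (S i) u) \<longlonglongrightarrow> 0"
      using S by (intro localized_continuous_at_empty[OF u pos]) auto
    then show "(\<lambda>i. ennreal (localized (S i) u)) \<longlonglongrightarrow> 0"
      using tendsto_ennrealI by fastforce
  qed auto
  have \<mu>_eq: "emeasure \<mu> S = ennreal (localized S u)" if "S \<in> sets A" for S
    using ca that empty unfolding \<mu>_def
    by (intro emeasure_measure_of_sigma) (auto simp: positive_def sets.sigma_algebra_axioms)
  have sets_\<mu>: "sets \<mu> = sets A" by (simp add: \<mu>_def)
  have "absolutely_continuous A \<mu>"
    unfolding absolutely_continuous_def
  proof
    fix S assume "S \<in> null_sets A"
    then have S: "S \<in> sets A" "measure A S = 0" by (auto simp: measure_def)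
    then have "(\<lambda>i::nat. localized S u) \<longlonglongrightarrow> 0"
      by (intro localized_continuous_at_empty[OF u pos]) auto
    then have "localized S u = 0" by (simp add: LIMSEQ_const_iff)
    then show "S \<in> null_sets \<mu>" using S \<mu>_eq[of S] sets_\<mu> by (simp add: null_sets_def)
  qed
  then obtain f where f[measurable]: "f \<in> borel_measurable A" and dens: "density A f = \<mu>"
    using X.Radon_Nikodym[OF _ sets_\<mu>] by blast
  have f_int: "(\<integral>\<^sup>+x. f x * indicator S x \<partial>A) = ennreal (localized S u)" if "S \<in> sets A" for S
    using that \<mu>_eq[OF that] by (simp add: dens[symmetric] emeasure_density)
  have "(\<integral>\<^sup>+x. f x \<partial>A) = (\<integral>\<^sup>+x. f x * indicator (space A) x \<partial>A)"
    by (intro nn_integral_cong) simp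
  then have "(\<integral>\<^sup>+x. f x \<partial>A) \<noteq> \<infinity>" using f_int[of "space A"] by simp
  then have fin: "AE x in A. f x \<noteq> \<infinity>" by (intro nn_integral_PInf_AE) auto
  define w where "w x = enn2real (f x)" for x
  have [measurable]: "w \<in> borel_measurable A" unfolding w_def[abs_def] by measurable
  have w_nn: "(\<integral>\<^sup>+x. ennreal (indicator S x * w x) \<partial>A) = ennreal (localized S u)" if "S \<in> sets A" for S
  proof -
    have "(\<integral>\<^sup>+x. ennreal (indicator S x * w x) \<partial>A) = (\<integral>\<^sup>+x. f x * indicator S x \<partial>A)"
      using fin
      by (intro nn_integral_cong_AE) (auto simp: w_def indicator_def top.not_eq_extremum elim!: eventually_mono)
    then show ?thesis using f_int[OF that] by simp
  qed
  show ?thesis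
  proof (intro exI[of _ w] conjI allI ballI)
    have "(\<integral>\<^sup>+x. ennreal (w x) \<partial>A) = (\<integral>\<^sup>+x. ennreal (indicator (space A) x * w x) \<partial>A)"
      by (intro nn_integral_cong) simp
    then have "(\<integral>\<^sup>+x. ennreal (w x) \<partial>A) < \<infinity>" using w_nn[of "space A"] by simp
    then show "integrable A w" by (intro integrableI_nonneg) (auto simp: w_def)
    show "0 \<le> w x" for x by (simp add: w_def)
    fix S assume S: "S \<in> sets A"
    have "(\<integral>x\<in>S. w x \<partial>A) = (\<integral>x. indicator S x * w x \<partial>A)"
      by (simp add: set_lebesgue_integral_def)
    also have "\<dots> = enn2real (\<integral>\<^sup>+x. ennreal (indicator S x * w x) \<partial>A)"
      using S by (intro integral_eq_nn_integral) (auto simp: w_def)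
    finally show "(\<integral>x\<in>S. w x \<partial>A) = localized S u" using w_nn[OF S] mu_nonneg by simp
  qed
qed

lemma localized_density:
  assumes u: "integrable B u"
  shows "\<exists>w. integrable A w \<and> (\<forall>S\<in>sets A. (\<integral>x\<in>S. w x \<partial>A) = localized S u)"
proof -
  have pos: "integrable B (\<lambda>y. max 0 (u y))" and neg: "integrable B (\<lambda>y. max 0 (- u y))" using u by auto
  obtain w1 where w1: "integrable A w1" "\<And>S. S \<in> sets A \<Longrightarrow> (\<integral>x\<in>S. w1 x \<partial>A) = localized S (\<lambda>y. max 0 (u y))"
    using localized_density_nonneg[OF pos max.cobounded1] by blast
  obtain w2 where w2: "integrable A w2" "\<And>S. S \<in> sets A \<Longrightarrow> (\<integral>x\<in>S. w2 x \<partial>A) = localized S (\<lambda>y. max 0 (- u y))"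
    using localized_density_nonneg[OF neg max.cobounded1] by blast
  have "localized S u = localized S (\<lambda>y. max 0 (u y)) - localized S (\<lambda>y. max 0 (- u y))" for S
  proof -
    have "u = (\<lambda>y. max 0 (u y) + - 1 * max 0 (- u y))" by (auto simp: max_def)
    then have "localized S u = localized S (\<lambda>y. max 0 (u y) + - 1 * max 0 (- u y))" by simp
    then show ?thesis
      using localized_add[OF pos, of "\<lambda>y. - 1 * max 0 (- u y)" S] localized_scale[OF neg, of S "- 1"] neg by simp
  qed
  moreover have "(\<integral>x\<in>S. (w1 x - w2 x) \<partial>A) = (\<integral>x\<in>S. w1 x \<partial>A) - (\<integral>x\<in>S. w2 x \<partial>A)" if "S \<in> sets A" for S
    using w1(1) w2(1) that
    by (intro set_integral_diff) (auto simp: set_integrable_def intro: integrable_mult_indicator[where 'b = real, simplified])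
  ultimately show ?thesis
    using w1 w2 by (intro exI[of _ "\<lambda>x. w1 x - w2 x"]) auto
qed

text \<open>
  All properties of \<open>D\<close> compare integrable functions up to null sets, and such functions
  are determined by their integrals over measurable sets; so each property of \<open>D\<close> is inherited from
  the corresponding property of \<open>localized\<close>.
\<close>

theorem doubly_stochastic_operator_of_functional:
  "\<exists>D. doubly_stochastic_operator B A D \<and>
    (\<forall>u. integrable B u \<longrightarrow> integrable A (D u) \<and> (\<forall>S\<in>sets A. (\<integral>x\<in>S. D u x \<partial>A) = localized S u))"
proof -
  define D where "D u = (SOME w. integrable A w \<and> (\<forall>S\<in>sets A. (\<integral>x\<in>S. w x \<partial>A) = localized S u))" for u
  have D: "integrable A (D u) \<and> (\<forall>S\<in>sets A. (\<integral>x\<in>S. D u x \<partial>A) = localized S u)" if "integrable B u" for u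
    unfolding D_def by (rule someI_ex[OF localized_density[OF that]])
  then have D_int: "integrable A (D u)" and D_loc: "S \<in> sets A \<Longrightarrow> (\<integral>x\<in>S. D u x \<partial>A) = localized S u"
    if "integrable B u" for u S using that by auto
  have set_int: "set_integrable A S w" if "integrable A w" "S \<in> sets A" for S and w :: "'a \<Rightarrow> real"
    using that by (simp add: set_integrable_def integrable_mult_indicator[where 'b = real, simplified])
  have eqI: "AE x in A. D u x = w x"
    if "integrable B u" "integrable A w" "\<And>S. S \<in> sets A \<Longrightarrow> (\<integral>x\<in>S. w x \<partial>A) = localized S u" for u w
    using that D_int D_loc by (intro density_unique_real) auto
  have "L1_linear B A D"
    unfolding L1_linear_def
  proof (intro conjI allI impI)
    show "integrable A (D u)" if "integrable B u" for u by (rule D_int[OF that])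
    show "AE x in A. D u x = D v x" if "integrable B u" "integrable B v" "AE y in B. u y = v y" for u v
    proof (rule eqI[OF that(1) D_int[OF that(2)]])
      fix S assume "S \<in> sets A"
      then show "(\<integral>x\<in>S. D v x \<partial>A) = localized S u"
        using D_loc[OF that(2)] localized_cong_AE[OF that, of S] by simp
    qed
    show "AE x in A. D (\<lambda>y. u y + v y) x = D u x + D v x" if uv: "integrable B u" "integrable B v" for u v
    proof (rule eqI)
      fix S assume S: "S \<in> sets A"
      show "(\<integral>x\<in>S. (D u x + D v x) \<partial>A) = localized S (\<lambda>y. u y + v y)"
        using uv S set_integral_add(2)[OF set_int[OF D_int S] set_int[OF D_int S]]
        by (simp add: D_loc localized_add)
    qed (use uv D_int in auto)
    show "AE x in A. D (\<lambda>y. c * u y) x = c * D u x" if u: "integrable B u" for c u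
    proof (rule eqI)
      fix S assume S: "S \<in> sets A"
      show "(\<integral>x\<in>S. c * D u x \<partial>A) = localized S (\<lambda>y. c * u y)"
        using u S by (simp add: D_loc localized_scale)
    qed (use u D_int in auto)
  qed
  moreover have "AE x in A. 0 \<le> D u x" if u: "integrable B u" "AE y in B. 0 \<le> u y" for u
  proof -
    have pos: "integrable B (\<lambda>y. max 0 (u y))" using u by auto
    obtain w where w: "integrable A w" "\<And>x. 0 \<le> w x"
      and loc: "\<And>S. S \<in> sets A \<Longrightarrow> (\<integral>x\<in>S. w x \<partial>A) = localized S (\<lambda>y. max 0 (u y))"
      using localized_density_nonneg[OF pos max.cobounded1] by blast
    have "localized S (\<lambda>y. max 0 (u y)) = localized S u" for S
      using u by (intro localized_cong_AE pos) (auto elim!: eventually_mono)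
    then have "AE x in A. D u x = w x" using loc by (intro eqI u w) auto
    then show ?thesis using w(2) by (auto elim!: eventually_mono)
  qed
  moreover have "(\<integral>x. D u x \<partial>A) = (\<integral>y. u y \<partial>B)" if u: "integrable B u" for u
    using D_loc[OF u, of "space A"] localized_space[OF u] set_integral_space[OF D_int[OF u]] by simp
  moreover have "AE x in A. D (\<lambda>y. 1) x = 1"
    using localized_one by (intro eqI) (auto simp: set_lebesgue_integral_def)
  moreover have "emeasure A (space A) = emeasure B (space B)"
    using localized_one[of "space A"] localized_space[of "\<lambda>_. 1"]
    by (simp add: X.emeasure_eq_measure Y.emeasure_eq_measure)
  ultimately have "doubly_stochastic_operator B A D"
    unfolding doubly_stochastic_operator_def stochastic_operator_def
    using X.sigma_finite_measure_axioms Y.sigma_finite_measure_axioms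
    by (auto simp: less_top[symmetric])
  then show ?thesis using D by blast
qed

end

text \<open>
  The functions \<open>D G\<close> and \<open>F\<close> have the same integral over every \<open>S\<close>, because \<open>\<Lambda>\<close> does not distinguish
  \<open>1\<^sub>S(x) G y\<close> from \<open>1\<^sub>S(x) F x\<close>.
\<close>

theorem (in convex_dominated) doubly_stochastic_operator_exists:
  "\<exists>D. doubly_stochastic_operator B A D \<and> (AE x in A. D G x = F x)"
proof -
  obtain \<Lambda> where *: "coupling_functional A B \<Lambda> \<and>
      (\<forall>S. \<Lambda> (\<lambda>z. indicator S (fst z) * (G (snd z) - F (fst z))) = 0)"
    using martingale_coupling_functional by (rule exE)
  note \<Lambda> = conjunct1[OF *] and martingale = spec[OF conjunct2[OF *]]
  interpret coupling_functional A B \<Lambda> by (rule \<Lambda>)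
  obtain D where D: "doubly_stochastic_operator B A D" and D_int: "integrable A (D G)"
    and D_loc: "\<And>S. S \<in> sets A \<Longrightarrow> (\<integral>x\<in>S. D G x \<partial>A) = localized S G"
    using doubly_stochastic_operator_of_functional G_int by blast
  have "AE x in A. D G x = F x"
  proof (rule density_unique_real[OF D_int F_int])
    fix S assume S: "S \<in> sets A"
    have SF: "integrable A (\<lambda>x. indicator S x * F x)"
      using S F_int by (simp add: integrable_mult_indicator[where 'b = real, simplified])
    have W: "(\<lambda>z. indicator S (fst z) * F (fst z)) \<in> marginally_bounded A B"
      using F_int by (intro marginally_boundedI[of _ "\<lambda>x. \<bar>F x\<bar>" _ "\<lambda>_. 0"]) (auto simp: indicator_def)
    have "localized S G - (\<integral>x. indicator S x * F x \<partial>A)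
        = \<Lambda> (\<lambda>z. indicator S (fst z) * G (snd z) + - 1 * (indicator S (fst z) * F (fst z)))"
      using \<Lambda>_add[OF localized_in_domain[OF G_int] function_subspaceD(3)[OF function_subspace_marginally_bounded W], of S "- 1"]
        \<Lambda>_scale[OF W, of "- 1"] left_marginal[OF SF]
      by (simp add: localized_def)
    also have "\<dots> = 0" using martingale[of S] by (simp add: algebra_simps)
    finally show "(\<integral>x\<in>S. D G x \<partial>A) = (\<integral>x\<in>S. F x \<partial>A)"
      using D_loc[OF S] by (simp add: set_lebesgue_integral_def)
  qed
  with D show ?thesis by blast
qed

section \<open>Jensen inequality for stochastic operators\<close>

text \<open>
  A convex function on the line is the supremum of countably many supporting lines.  Rational
  points \<open>s\<close> are taken from the right of \<open>t\<close>, since there \<open>m s \<le> \<phi> (s + 1) - \<phi> s\<close> bounds the slope from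
  the side needed for \<open>m s * (t - s)\<close> to tend to zero.
\<close>

lemma convex_le_if_rational_tangents_le:
  fixes \<phi> m :: "real \<Rightarrow> real"
  assumes \<phi>: "convex_on UNIV \<phi>"
    and tangent: "\<And>s t. \<phi> s + m s * (t - s) \<le> \<phi> t"
    and le: "\<And>q :: rat. \<phi> (of_rat q) + m (of_rat q) * (t - of_rat q) \<le> z"
  shows "\<phi> t \<le> z"
proof -
  have "\<exists>q :: rat. t < of_rat q \<and> of_rat q < t + 1 / real (Suc n)" for n
    by (rule of_rat_dense) simp
  then obtain q :: "nat \<Rightarrow> rat" where q: "\<And>n. t < of_rat (q n)" "\<And>n. of_rat (q n) < t + 1 / real (Suc n)"
    by metis
  define s where "s n = (of_rat (q n) :: real)" for n
  have "(\<lambda>n. t + 1 / real (Suc n)) \<longlonglongrightarrow> t + 0"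
    by (intro tendsto_intros LIMSEQ_Suc[OF lim_1_over_n])
  then have s_lim: "s \<longlonglongrightarrow> t"
    using q by (intro tendsto_sandwich[of "\<lambda>_. t" s sequentially "\<lambda>n. t + 1 / real (Suc n)"])
      (auto simp: s_def less_imp_le intro!: always_eventually)
  have cont: "isCont \<phi> x" for x
    using convex_on_continuous[OF open_UNIV \<phi>] by (simp add: continuous_on_eq_continuous_at)
  have "(\<lambda>n. \<phi> (s n) + (\<phi> (s n + 1) - \<phi> (s n)) * (t - s n)) \<longlonglongrightarrow> \<phi> t + (\<phi> (t + 1) - \<phi> t) * (t - t)"
    by (intro tendsto_intros isCont_tendsto_compose[OF cont] s_lim)
  moreover have "\<phi> (s n) + (\<phi> (s n + 1) - \<phi> (s n)) * (t - s n) \<le> z" for n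
  proof -
    have "m (s n) \<le> \<phi> (s n + 1) - \<phi> (s n)" using tangent[of "s n" "s n + 1"] by simp
    then have "(\<phi> (s n + 1) - \<phi> (s n)) * (t - s n) \<le> m (s n) * (t - s n)"
      using q(1)[of n] by (intro mult_right_mono_neg) (auto simp: s_def)
    then show ?thesis using le[of "q n"] by (simp add: s_def)
  qed
  ultimately show ?thesis
    by (intro LIMSEQ_le_const2) auto
qed

lemma stochastic_operator_mono:
  assumes S: "stochastic_operator N M S" and u: "integrable N u" and v: "integrable N v"
    and le: "AE y in N. u y \<le> v y"
  shows "AE x in M. S u x \<le> S v x"
proof -
  have L: "L1_linear N M S" using S by (simp add: stochastic_operator_def)
  have mu: "integrable N (\<lambda>y. - 1 * u y)" using u by auto
  have diff: "integrable N (\<lambda>y. v y + - 1 * u y)" using u v by auto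
  have "AE y in N. 0 \<le> v y + - 1 * u y" using le by auto
  then have "AE x in M. 0 \<le> S (\<lambda>y. v y + - 1 * u y) x"
    using S diff unfolding stochastic_operator_def by blast
  moreover have "AE x in M. S (\<lambda>y. v y + - 1 * u y) x = S v x + S (\<lambda>y. - 1 * u y) x"
    using L v mu unfolding L1_linear_def by blast
  moreover have "AE x in M. S (\<lambda>y. - 1 * u y) x = - 1 * S u x"
    using L u unfolding L1_linear_def by blast
  ultimately show ?thesis by eventually_elim simp
qed

lemma stochastic_operator_lincomb:
  assumes S: "stochastic_operator N M S" and u: "integrable N u" and v: "integrable N v"
  shows "AE x in M. S (\<lambda>y. a * u y + b * v y) x = a * S u x + b * S v x"
proof -
  have L: "L1_linear N M S" using S by (simp add: stochastic_operator_def)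
  have au: "integrable N (\<lambda>y. a * u y)" and bv: "integrable N (\<lambda>y. b * v y)" using u v by auto
  have "AE x in M. S (\<lambda>y. a * u y + b * v y) x = S (\<lambda>y. a * u y) x + S (\<lambda>y. b * v y) x"
    using L au bv unfolding L1_linear_def by blast
  moreover have "AE x in M. S (\<lambda>y. a * u y) x = a * S u x"
    using L u unfolding L1_linear_def by blast
  moreover have "AE x in M. S (\<lambda>y. b * v y) x = b * S v x"
    using L v unfolding L1_linear_def by blast
  ultimately show ?thesis by eventually_elim simp
qed

text \<open>
  Each supporting line \<open>\<phi> s + m s * (t - s)\<close> turns into the inequality
  \<open>(\<phi> s - m s * s) k + m s * g \<le> \<phi> (g / k) k\<close> between integrable functions, to which \<open>S\<close> can be applied.
  Only countably many \<open>s\<close> are needed, so the exceptional null sets cause no harm.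
\<close>

lemma stochastic_operator_jensen:
  fixes \<phi> :: "real \<Rightarrow> real"
  assumes S: "stochastic_operator N M S" and g: "integrable N g" and k: "integrable N k"
    and k_pos: "AE y in N. 0 < k y" and h_pos: "AE x in M. 0 < h x"
    and Sg: "AE x in M. S g x = f x" and Sk: "AE x in M. S k x = h x"
    and \<phi>: "convex_on UNIV \<phi>" and w: "integrable N (\<lambda>y. \<phi> (g y / k y) * k y)"
  shows "AE x in M. \<phi> (f x / h x) * h x \<le> S (\<lambda>y. \<phi> (g y / k y) * k y) x"
proof -
  \<comment> \<open>The right derivative of \<open>\<phi>\<close>, a choice of subgradient at every point.\<close>
  define m where "m s = Inf ((\<lambda>t. (\<phi> s - \<phi> t) / (s - t)) ` ({s<..} \<inter> UNIV))" for s
  have tangent: "\<phi> s + m s * (t - s) \<le> \<phi> t" for s t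
    using convex_le_Inf_differential[OF \<phi>, of s t] by (simp add: m_def)
  have "AE x in M. (\<phi> s - m s * s) * h x + m s * f x \<le> S (\<lambda>y. \<phi> (g y / k y) * k y) x" for s
  proof -
    have "AE y in N. (\<phi> s - m s * s) * k y + m s * g y \<le> \<phi> (g y / k y) * k y"
      using k_pos
    proof eventually_elim
      case (elim y)
      have "(\<phi> s + m s * (g y / k y - s)) * k y \<le> \<phi> (g y / k y) * k y"
        using elim by (intro mult_right_mono tangent) auto
      moreover have "(\<phi> s + m s * (g y / k y - s)) * k y = (\<phi> s - m s * s) * k y + m s * g y"
        using elim by (simp add: field_simps)
      ultimately show ?case by simp
    qed
    then have "AE x in M. S (\<lambda>y. (\<phi> s - m s * s) * k y + m s * g y) x \<le> S (\<lambda>y. \<phi> (g y / k y) * k y) x"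
      using g k by (intro stochastic_operator_mono[OF S _ w]) auto
    with stochastic_operator_lincomb[OF S k g, of "\<phi> s - m s * s" "m s"] Sg Sk show ?thesis
      by eventually_elim simp
  qed
  then have "AE x in M. \<forall>q :: rat. (\<phi> (of_rat q) - m (of_rat q) * of_rat q) * h x + m (of_rat q) * f x
      \<le> S (\<lambda>y. \<phi> (g y / k y) * k y) x"
    unfolding AE_all_countable by blast
  with h_pos show ?thesis
  proof eventually_elim
    case (elim x)
    have "\<phi> (f x / h x) \<le> S (\<lambda>y. \<phi> (g y / k y) * k y) x / h x"
    proof (rule convex_le_if_rational_tangents_le[OF \<phi> tangent])
      fix q :: rat
      have "(\<phi> (of_rat q) + m (of_rat q) * (f x / h x - of_rat q)) * h x
          = (\<phi> (of_rat q) - m (of_rat q) * of_rat q) * h x + m (of_rat q) * f x"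
        using elim(1) by (simp add: field_simps)
      also have "\<dots> \<le> S (\<lambda>y. \<phi> (g y / k y) * k y) x" using elim(2) by blast
      finally show "\<phi> (of_rat q) + m (of_rat q) * (f x / h x - of_rat q) \<le> S (\<lambda>y. \<phi> (g y / k y) * k y) x / h x"
        using elim(1) by (simp add: pos_le_divide_eq)
    qed
    then show ?case using elim(1) by (simp add: pos_le_divide_eq)
  qed
qed

lemma measurable_convex_perspective:
  fixes \<phi> :: "real \<Rightarrow> real"
  assumes \<phi>: "convex_on UNIV \<phi>" and "f \<in> borel_measurable M" "h \<in> borel_measurable M"
  shows "(\<lambda>x. \<phi> (f x / h x) * h x) \<in> borel_measurable M"
proof -
  have [measurable]: "\<phi> \<in> borel_measurable borel"
    using convex_on_continuous[OF open_UNIV \<phi>] by (rule borel_measurable_continuous_onI)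
  show ?thesis using assms by measurable
qed

lemma extended_integral_eq_infinity:
  assumes "F \<in> borel_measurable M" and "(\<integral>\<^sup>+x. ennreal (- F x) \<partial>M) < \<infinity>" and "\<not> integrable M F"
  shows "extended_integral M F = \<infinity>"
proof -
  have pos: "(\<integral>\<^sup>+x. ennreal (F x) \<partial>M) = \<infinity>"
    using assms by (auto simp: real_integrable_def)
  obtain r where "(\<integral>\<^sup>+x. ennreal (- F x) \<partial>M) = ennreal r" "0 \<le> r"
    using assms(2) by (auto simp: less_top_ennreal)
  then show ?thesis by (simp add: extended_integral_def pos)
qed

text \<open>
  If \<open>\<phi> (g / k) k\<close> is integrable, integrating Jensen's inequality gives the claim, since \<open>S\<close> preserves
  integrals; otherwise the right-hand side is infinite.
\<close>

theorem stochastic_operator_convex_order: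
  fixes \<phi> :: "real \<Rightarrow> real"
  assumes S: "stochastic_operator N M S" and f: "integrable M f" and h: "integrable M h"
    and g: "integrable N g" and k: "integrable N k"
    and k_pos: "AE y in N. 0 < k y" and h_pos: "AE x in M. 0 < h x"
    and Sg: "AE x in M. S g x = f x" and Sk: "AE x in M. S k x = h x"
    and \<phi>: "convex_on UNIV \<phi>"
  shows "extended_integral M (\<lambda>x. \<phi> (f x / h x) * h x) \<le> extended_integral N (\<lambda>y. \<phi> (g y / k y) * k y)"
proof (cases "integrable N (\<lambda>y. \<phi> (g y / k y) * k y)")
  case w: True
  let ?v = "\<lambda>x. \<phi> (f x / h x) * h x" and ?w = "\<lambda>y. \<phi> (g y / k y) * k y"
  have Sw: "integrable M (S ?w)" and Sw_int: "(\<integral>x. S ?w x \<partial>M) = (\<integral>y. ?w y \<partial>N)"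
    using S w by (auto simp: stochastic_operator_def L1_linear_def)
  have jensen: "AE x in M. ?v x \<le> S ?w x"
    by (rule stochastic_operator_jensen[OF S g k k_pos h_pos Sg Sk \<phi> w])
  have "(\<integral>\<^sup>+x. ennreal (?v x) \<partial>M) \<le> (\<integral>\<^sup>+x. ennreal (S ?w x) \<partial>M)"
    using jensen by (intro nn_integral_mono_AE) (auto intro: ennreal_leI)
  also have "\<dots> < \<infinity>" using Sw by (auto simp: real_integrable_def less_top)
  finally have "(\<integral>\<^sup>+x. ennreal (?v x) \<partial>M) < \<infinity>" .
  moreover have "?v \<in> borel_measurable M"
    using f h by (intro measurable_convex_perspective \<phi>) auto
  ultimately have v: "integrable M ?v"
    using convex_perspective_negative_part[OF \<phi> f h h_pos] unfolding real_integrable_def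
    by (simp add: less_top)
  have "(\<integral>x. ?v x \<partial>M) \<le> (\<integral>x. S ?w x \<partial>M)" by (rule integral_mono_AE[OF v Sw jensen])
  then show ?thesis using Sw_int by (simp add: extended_integral_eq_integral v w)
next
  case False
  then have "extended_integral N (\<lambda>y. \<phi> (g y / k y) * k y) = \<infinity>"
    using g k by (intro extended_integral_eq_infinity measurable_convex_perspective \<phi>
        convex_perspective_negative_part k_pos) auto
  then show ?thesis by simp
qed

section \<open>Change of reference measure\<close>

lemma integrable_density_iff_mult:
  fixes h u :: "'a \<Rightarrow> real"
  assumes h: "h \<in> borel_measurable M" "AE x in M. 0 < h x" and u: "u \<in> borel_measurable M"
  shows "integrable (density M (\<lambda>x. ennreal (h x))) u \<longleftrightarrow> integrable M (\<lambda>x. h x * u x)"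
    and "(\<integral>x. u x \<partial>density M (\<lambda>x. ennreal (h x))) = (\<integral>x. h x * u x \<partial>M)"
proof -
  have nonneg: "AE x in M. 0 \<le> h x" using h(2) by (auto elim!: eventually_mono)
  show "integrable (density M (\<lambda>x. ennreal (h x))) u \<longleftrightarrow> integrable M (\<lambda>x. h x * u x)"
    using integrable_density[OF u h(1) nonneg] by simp
  show "(\<integral>x. u x \<partial>density M (\<lambda>x. ennreal (h x))) = (\<integral>x. h x * u x \<partial>M)"
    using integral_density[OF u h(1) nonneg] by simp
qed

lemma AE_positive_density:
  assumes "h \<in> borel_measurable M" "AE x in M. 0 < (h x :: real)"
  shows "(AE x in density M (\<lambda>x. ennreal (h x)). P x) \<longleftrightarrow> (AE x in M. P x)"
proof -
  have "(AE x in density M (\<lambda>x. ennreal (h x)). P x) \<longleftrightarrow> (AE x in M. 0 < ennreal (h x) \<longrightarrow> P x)"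
    using assms(1) by (intro AE_density) auto
  also have "\<dots> \<longleftrightarrow> (AE x in M. P x)"
  proof
    assume "AE x in M. 0 < ennreal (h x) \<longrightarrow> P x"
    with assms(2) show "AE x in M. P x" by eventually_elim simp
  qed auto
  finally show ?thesis .
qed

text \<open>
  Multiplication by a positive density identifies the \<open>L\<^sup>1\<close> space of the weighted measure with that of
  the original one, preserving order and integrals; \<open>S\<close> is \<open>D\<close> transported along these identifications,
  under which the constant \<open>1\<close> corresponds to \<open>k\<close> and to \<open>h\<close>.
\<close>

theorem stochastic_operator_of_doubly_stochastic:
  fixes M :: "'a measure" and N :: "'b measure"
    and h :: "'a \<Rightarrow> real" and k :: "'b \<Rightarrow> real"
  assumes M: "sigma_finite_measure M" and N: "sigma_finite_measure N"
    and h: "h \<in> borel_measurable M" "AE x in M. 0 < h x"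
    and k: "integrable N k" "AE y in N. 0 < k y"
    and D: "doubly_stochastic_operator (density N (\<lambda>y. ennreal (k y))) (density M (\<lambda>x. ennreal (h x))) D"
  defines "S \<equiv> \<lambda>u x. h x * D (\<lambda>y. u y / k y) x"
  shows "stochastic_operator N M S" and "AE x in M. S k x = h x"
proof -
  let ?\<alpha> = "density M (\<lambda>x. ennreal (h x))" and ?\<beta> = "density N (\<lambda>y. ennreal (k y))"
  have k_meas: "k \<in> borel_measurable N" using k(1) by auto
  note AE_\<alpha> = AE_positive_density[OF h] and AE_\<beta> = AE_positive_density[OF k_meas k(2)]
  have L: "L1_linear ?\<beta> ?\<alpha> D"
    and pos: "\<And>u. integrable ?\<beta> u \<Longrightarrow> (AE y in ?\<beta>. 0 \<le> u y) \<Longrightarrow> (AE x in ?\<alpha>. 0 \<le> D u x)"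
    and int: "\<And>u. integrable ?\<beta> u \<Longrightarrow> (\<integral>x. D u x \<partial>?\<alpha>) = (\<integral>y. u y \<partial>?\<beta>)"
    and one: "AE x in ?\<alpha>. D (\<lambda>y. 1) x = 1"
    using D by (auto simp: doubly_stochastic_operator_def stochastic_operator_def)
  have L1: "\<And>u. integrable ?\<beta> u \<Longrightarrow> integrable ?\<alpha> (D u)"
    and L2: "\<And>u v. integrable ?\<beta> u \<Longrightarrow> integrable ?\<beta> v \<Longrightarrow> (AE y in ?\<beta>. u y = v y) \<Longrightarrow> (AE x in ?\<alpha>. D u x = D v x)"
    and L3: "\<And>u v. integrable ?\<beta> u \<Longrightarrow> integrable ?\<beta> v \<Longrightarrow> (AE x in ?\<alpha>. D (\<lambda>y. u y + v y) x = D u x + D v x)"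
    and L4: "\<And>c u. integrable ?\<beta> u \<Longrightarrow> (AE x in ?\<alpha>. D (\<lambda>y. c * u y) x = c * D u x)"
    using L by (simp_all add: L1_linear_def)
  have cancel: "AE y in N. k y * (u y / k y) = u y" for u :: "'b \<Rightarrow> real"
    using k(2) by eventually_elim simp
  have quot: "integrable ?\<beta> (\<lambda>y. u y / k y)"
    and quot_int: "(\<integral>y. u y / k y \<partial>?\<beta>) = (\<integral>y. u y \<partial>N)" if u: "integrable N u" for u
  proof -
    have meas: "(\<lambda>y. u y / k y) \<in> borel_measurable N" using u k_meas by auto
    have "integrable N (\<lambda>y. k y * (u y / k y)) \<longleftrightarrow> integrable N u"
      using u k_meas meas by (intro integrable_cong_AE cancel) auto
    then show "integrable ?\<beta> (\<lambda>y. u y / k y)"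
      using u by (simp add: integrable_density_iff_mult(1)[OF k_meas k(2) meas])
    have "(\<integral>y. k y * (u y / k y) \<partial>N) = (\<integral>y. u y \<partial>N)"
      using u k_meas meas by (intro integral_cong_AE cancel) auto
    then show "(\<integral>y. u y / k y \<partial>?\<beta>) = (\<integral>y. u y \<partial>N)"
      by (simp add: integrable_density_iff_mult(2)[OF k_meas k(2) meas])
  qed
  have D_meas: "D (\<lambda>y. u y / k y) \<in> borel_measurable M" if "integrable N u" for u
    using borel_measurable_integrable[OF L1[OF quot[OF that]]] by simp
  show "stochastic_operator N M S"
    unfolding stochastic_operator_def L1_linear_def
  proof (intro conjI allI impI)
    show "sigma_finite_measure N" "sigma_finite_measure M" by fact+
    show "integrable M (S u)" if u: "integrable N u" for u
      using L1[OF quot[OF u]] integrable_density_iff_mult(1)[OF h D_meas[OF u]] by (simp add: S_def)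
    show "AE x in M. S u x = S v x" if "integrable N u" "integrable N v" "AE y in N. u y = v y" for u v
    proof -
      have "AE y in ?\<beta>. u y / k y = v y / k y"
        unfolding AE_\<beta> using that(3) by eventually_elim simp
      from L2[OF quot[OF that(1)] quot[OF that(2)] this] show ?thesis
        unfolding AE_\<alpha> by eventually_elim (simp add: S_def)
    qed
    show "AE x in M. S (\<lambda>y. u y + v y) x = S u x + S v x" if "integrable N u" "integrable N v" for u v
      using L3[OF quot[OF that(1)] quot[OF that(2)]]
      unfolding AE_\<alpha> S_def add_divide_distrib by eventually_elim (simp add: distrib_left)
    show "AE x in M. S (\<lambda>y. c * u y) x = c * S u x" if "integrable N u" for c u
      using L4[OF quot[OF that], of c]
      unfolding AE_\<alpha> S_def times_divide_eq_right by eventually_elim simp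
    show "AE x in M. 0 \<le> S u x" if u: "integrable N u" "AE y in N. 0 \<le> u y" for u
    proof -
      have "AE y in ?\<beta>. 0 \<le> u y / k y"
        unfolding AE_\<beta> using u(2) k(2) by eventually_elim simp
      from pos[OF quot[OF u(1)] this] h(2) show ?thesis
        unfolding AE_\<alpha> by eventually_elim (simp add: S_def)
    qed
    show "(\<integral>x. S u x \<partial>M) = (\<integral>y. u y \<partial>N)" if u: "integrable N u" for u
    proof -
      have "(\<integral>x. S u x \<partial>M) = (\<integral>x. D (\<lambda>y. u y / k y) x \<partial>?\<alpha>)"
        using integrable_density_iff_mult(2)[OF h D_meas[OF u]] by (simp add: S_def)
      then show ?thesis using int[OF quot[OF u]] quot_int[OF u] by simp
    qed
  qed
  show "AE x in M. S k x = h x"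
  proof -
    have "AE y in ?\<beta>. k y / k y = 1"
      unfolding AE_\<beta> using k(2) by eventually_elim simp
    moreover have "integrable ?\<beta> (\<lambda>y. 1 :: real)"
      using k integrable_density_iff_mult(1)[OF k_meas k(2), of "\<lambda>_. 1"] by simp
    ultimately have "AE x in ?\<alpha>. D (\<lambda>y. k y / k y) x = D (\<lambda>y. 1) x"
      by (intro L2 quot k(1))
    with one show ?thesis
      unfolding AE_\<alpha> by eventually_elim (simp add: S_def)
  qed
qed

lemma AE_zero_measure:
  assumes "emeasure A (space A) = 0"
  shows "AE x in A. P x"
  using assms by (intro AE_I'[of "space A"]) (auto simp: null_sets_def)

lemma doubly_stochastic_operator_zero_measure:
  assumes A: "emeasure A (space A) = 0" and B: "emeasure B (space B) = 0"
  shows "doubly_stochastic_operator B A (\<lambda>u x. 0)"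
proof -
  have "finite_measure A" "finite_measure B" using A B by (auto intro!: finite_measureI)
  then have "sigma_finite_measure A" "sigma_finite_measure B" by (auto simp: finite_measure_def)
  moreover have "(\<integral>y. u y \<partial>B) = 0" for u :: "'b \<Rightarrow> real"
    by (rule integral_eq_zero_AE[OF AE_zero_measure[OF B]])
  ultimately show ?thesis
    using A B AE_zero_measure[OF A]
    by (simp add: doubly_stochastic_operator_def stochastic_operator_def L1_linear_def)
qed

lemma emeasure_density_space:
  assumes "integrable M h" "AE x in M. 0 < (h x :: real)"
  shows "emeasure (density M (\<lambda>x. ennreal (h x))) (space M) = ennreal (\<integral>x. h x \<partial>M)"
proof -
  have "emeasure (density M (\<lambda>x. ennreal (h x))) (space M) = (\<integral>\<^sup>+x. ennreal (h x) * indicator (space M) x \<partial>M)"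
    using assms by (intro emeasure_density) auto
  also have "\<dots> = (\<integral>\<^sup>+x. ennreal (h x) \<partial>M)" by (intro nn_integral_cong) simp
  also have "\<dots> = ennreal (\<integral>x. h x \<partial>M)"
    using assms by (intro nn_integral_eq_integral) (auto elim!: eventually_mono)
  finally show ?thesis .
qed

section \<open>Equivalence of the three conditions\<close>

text \<open>
  With respect to \<open>\<alpha>\<close> and \<open>\<beta>\<close> the hypothesis says that \<open>f / h\<close> is dominated by \<open>g / k\<close> in the convex
  order.  If the total mass vanishes the underlying sets may be empty; every function is then zero
  almost everywhere, and the zero operator serves.
\<close>

theorem doubly_stochastic_operator_of_convex_order:
  fixes M :: "'a measure" and N :: "'b measure"
    and f h :: "'a \<Rightarrow> real" and g k :: "'b \<Rightarrow> real"
  assumes f: "integrable M f" and g: "integrable N g"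
    and h: "integrable M h" "AE x in M. 0 < h x"
    and k: "integrable N k" "AE y in N. 0 < k y"
    and mass: "(\<integral>x. h x \<partial>M) = (\<integral>y. k y \<partial>N)"
    and order: "\<And>\<phi> :: real \<Rightarrow> real. convex_on UNIV \<phi> \<Longrightarrow>
      extended_integral M (\<lambda>x. \<phi> (f x / h x) * h x) \<le> extended_integral N (\<lambda>y. \<phi> (g y / k y) * k y)"
  defines "\<alpha> \<equiv> density M (\<lambda>x. ennreal (h x))" and "\<beta> \<equiv> density N (\<lambda>y. ennreal (k y))"
  shows "\<exists>D. doubly_stochastic_operator \<beta> \<alpha> D \<and> (AE x in \<alpha>. D (\<lambda>y. g y / k y) x = f x / h x)"
proof (cases "(\<integral>x. h x \<partial>M) = 0")
  case True
  then have "emeasure \<alpha> (space \<alpha>) = 0" "emeasure \<beta> (space \<beta>) = 0"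
    using emeasure_density_space[OF h] emeasure_density_space[OF k] mass
    by (simp_all add: \<alpha>_def \<beta>_def)
  then show ?thesis
    using doubly_stochastic_operator_zero_measure AE_zero_measure by blast
next
  case False
  have h_meas: "h \<in> borel_measurable M" and k_meas: "k \<in> borel_measurable N"
    and f_meas: "f \<in> borel_measurable M" and g_meas: "g \<in> borel_measurable N"
    using h k f g by auto
  note int_\<alpha> = integrable_density_iff_mult[OF h_meas h(2), folded \<alpha>_def]
    and int_\<beta> = integrable_density_iff_mult[OF k_meas k(2), folded \<beta>_def]
  have "convex_dominated \<alpha> \<beta> (\<lambda>x. f x / h x) (\<lambda>y. g y / k y)"
  proof (intro convex_dominated.intro convex_dominated_axioms.intro)
    show "finite_measure \<alpha>" "finite_measure \<beta>"
      using emeasure_density_space[OF h] emeasure_density_space[OF k]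
      by (auto intro!: finite_measureI simp: \<alpha>_def \<beta>_def)
    have "integrable M (\<lambda>x. h x * (f x / h x))"
      using f h_meas h(2) by (subst integrable_cong_AE[where g = f]) (auto elim!: eventually_mono)
    then show "integrable \<alpha> (\<lambda>x. f x / h x)" using f_meas h_meas by (simp add: int_\<alpha>)
    have "integrable N (\<lambda>y. k y * (g y / k y))"
      using g k_meas k(2) by (subst integrable_cong_AE[where g = g]) (auto elim!: eventually_mono)
    then show "integrable \<beta> (\<lambda>y. g y / k y)" using g_meas k_meas by (simp add: int_\<beta>)
    show "space \<alpha> \<noteq> {}" "space \<beta> \<noteq> {}"
      using False mass by (auto simp: \<alpha>_def \<beta>_def Bochner_Integration.integral_empty)
    fix \<psi> :: "real \<Rightarrow> real"
    assume \<psi>: "convex_on UNIV \<psi>" and F: "integrable \<alpha> (\<lambda>x. \<psi> (f x / h x))"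
      and G: "integrable \<beta> (\<lambda>y. \<psi> (g y / k y))"
    have \<psi>_meas[measurable]: "\<psi> \<in> borel_measurable borel"
      using convex_on_continuous[OF open_UNIV \<psi>] by (rule borel_measurable_continuous_onI)
    have F_meas: "(\<lambda>x. \<psi> (f x / h x)) \<in> borel_measurable M" using f_meas h_meas by measurable
    have G_meas: "(\<lambda>y. \<psi> (g y / k y)) \<in> borel_measurable N" using g_meas k_meas by measurable
    have F': "integrable M (\<lambda>x. \<psi> (f x / h x) * h x)"
      using F F_meas by (simp add: int_\<alpha> mult.commute)
    have G': "integrable N (\<lambda>y. \<psi> (g y / k y) * k y)"
      using G G_meas by (simp add: int_\<beta> mult.commute)
    have "(\<integral>x. \<psi> (f x / h x) * h x \<partial>M) \<le> (\<integral>y. \<psi> (g y / k y) * k y \<partial>N)"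
      using order[OF \<psi>] by (simp add: extended_integral_eq_integral F' G')
    then show "(\<integral>x. \<psi> (f x / h x) \<partial>\<alpha>) \<le> (\<integral>y. \<psi> (g y / k y) \<partial>\<beta>)"
      using F_meas G_meas by (simp add: int_\<alpha> int_\<beta> mult.commute)
  qed
  then show ?thesis by (rule convex_dominated.doubly_stochastic_operator_exists)
qed

theorem theorem3p12:
  fixes M :: "'a measure" and N :: "'b measure"
    and f h :: "'a \<Rightarrow> real" and g k :: "'b \<Rightarrow> real"
  assumes "finite_measure M" and "finite_measure N"
    and "integrable M f" and "integrable N g"
    and "integrable M h" and "AE x in M. 0 < h x"
    and "integrable N k" and "AE y in N. 0 < k y"
    and "(\<integral>x. h x \<partial>M) = (\<integral>y. k y \<partial>N)"
  defines "\<alpha> \<equiv> density M (\<lambda>x. ennreal (h x))"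
    and "\<beta> \<equiv> density N (\<lambda>y. ennreal (k y))"
  defines "cond1 \<equiv>
      (\<exists>S. stochastic_operator N M S \<and> (AE x in M. S g x = f x) \<and> (AE x in M. S k x = h x))"
    and "cond2 \<equiv>
      (\<forall>\<phi> :: real \<Rightarrow> real. convex_on UNIV \<phi> \<longrightarrow>
         extended_integral M (\<lambda>x. \<phi> (f x / h x) * h x)
           \<le> extended_integral N (\<lambda>y. \<phi> (g y / k y) * k y))"
    and "cond3 \<equiv>
      (\<exists>D. doubly_stochastic_operator \<beta> \<alpha> D \<and>
         (AE x in \<alpha>. D (\<lambda>y. g y / k y) x = f x / h x))"
  shows "(cond1 \<longleftrightarrow> cond2) \<and> (cond2 \<longleftrightarrow> cond3)"
proof -
  interpret M: finite_measure M by fact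
  interpret N: finite_measure N by fact
  have cond12: "cond2" if c1: cond1
  proof -
    obtain S where S: "stochastic_operator N M S" "AE x in M. S g x = f x" "AE x in M. S k x = h x"
      using c1 unfolding cond1_def by blast
    show ?thesis
      unfolding cond2_def
      using stochastic_operator_convex_order[OF S(1) assms(3,5,4,7,8,6) S(2,3)] by blast
  qed
  have cond23: "cond3" if c2: cond2
    unfolding cond3_def \<alpha>_def \<beta>_def
    using c2 unfolding cond2_def
    by (intro doubly_stochastic_operator_of_convex_order assms(3-9)) blast
  have cond31: "cond1" if c3: cond3
  proof -
    obtain D where D: "doubly_stochastic_operator \<beta> \<alpha> D" "AE x in \<alpha>. D (\<lambda>y. g y / k y) x = f x / h x"
      using c3 unfolding cond3_def by blast
    have h_meas: "h \<in> borel_measurable M" using assms(5) by auto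
    note S = stochastic_operator_of_doubly_stochastic[OF M.sigma_finite_measure_axioms
        N.sigma_finite_measure_axioms h_meas assms(6,7,8) D(1)[unfolded \<alpha>_def \<beta>_def]]
    have "AE x in M. h x * D (\<lambda>y. g y / k y) x = f x"
      using D(2)[unfolded \<alpha>_def AE_positive_density[OF h_meas assms(6)]] assms(6)
      by eventually_elim simp
    with S show ?thesis unfolding cond1_def by blast
  qed
  show ?thesis using cond12 cond23 cond31 by blast
qed

end
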